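(* Let $\varepsilon$ be an arbitrary but fixed positive number, let $n,r$ be positive integers with $r<n$, and let $u=n/r$. Then $$\kappa(n,r)=e^{-H_r}+O_\varepsilon\left(\frac{\nu(n,r)}{r}\exp\left\{-\frac{u^{1-4/r}(1-\varepsilon)}{4\pi^2(\log(u+1))^2}\right\}\right)$$ if $5\le r<n$, and $$\kappa(n,r)=e^{-H_r}+O\left(\nu(n,r)\,n^{5/2}\right)$$ if $2\le r<5$.
   Context: $S_n$ is the symmetric group on $n$ symbols and $k_j(\sigma)$ is the number of cycles of length $j$ in $\sigma\in S_n$. For $1\le r<n$ (a standing assumption for $\kappa$), $$\kappa(n,r)=\frac1{n!}\left|\{\sigma\in S_n:\ k_j(\sigma)=0\text{ for all }1\le j\le r\}\right|,$$ $$\nu(n,r)=\frac1{n!}\left|\{\sigma\in S_n:\ k_j(\sigma)=0 \text{ for all } r+1\le j\le n\}\right|.$$ $H_r=\sum_{j=1}^r1/j$. The implied constant in $O_\varepsilon$ may depend on $\varepsilon$ only; the implied constant in an unindexed $O$ is absolute; both are uniform over $n,r$ in the stated ranges. $\log$ is the natural logarithm. *)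

theory Defs
  imports "HOL-Analysis.Analysis" "HOL-Combinatorics.Combinatorics"
begin

(* cyclic_on s A says that A is a single orbit of s; a fixed point x is the
   orbit {x} and so counts as a cycle of length 1. *)
definition cycle_count :: "nat \<Rightarrow> nat \<Rightarrow> (nat \<Rightarrow> nat) \<Rightarrow> nat" where
  "cycle_count n j s = card {A. A \<subseteq> {1..n} \<and> cyclic_on s A \<and> card A = j}"

(* Only used for 1 \<le> r < n. *)
definition kappa :: "nat \<Rightarrow> nat \<Rightarrow> real" where
  "kappa n r =
     real (card {s. s permutes {1..n} \<and> (\<forall>j. 1 \<le> j \<and> j \<le> r \<longrightarrow> cycle_count n j s = 0)})
       / fact n"

definition nu :: "nat \<Rightarrow> nat \<Rightarrow> real" where
  "nu n r =
     real (card {s. s permutes {1..n} \<and> (\<forall>j. r + 1 \<le> j \<and> j \<le> n \<longrightarrow> cycle_count n j s = 0)})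
       / fact n"

end

theory Submission
  imports Defs "HOL-Complex_Analysis.Complex_Analysis" "HOL-Real_Asymp.Real_Asymp"
begin

text \<open>
  For $L(z) = \sum_{j=1}^r z^j/j$ one has $\sum_n \nu(n,r) z^n = e^{L(z)}$ and
  $\sum_n \kappa(n,r) z^n = e^{-L(z)}/(1-z)$. The second function has its only pole at $1$, with
  residue $-e^{-L(1)} = -e^{-H_r}$; moving the contour of Cauchy's formula to a circle of radius
  $x > 1$ therefore yields
  $$\kappa(n,r) - e^{-H_r} = \frac{1}{2\pi i} \oint_{|z| = x} \frac{e^{-L(z)}}{1-z}\, \frac{dz}{z^{n+1}}$$
  (lemma \<open>kappa_eq_error_integral\<close>). On that circle $|e^{-L(z)}|$ is much smaller than
  $e^{L(x)}$, because $L(x) + \mathrm{Re}\, L(z) = \sum_j (x^j/j) (1 + \mathrm{Re}\, \zeta^j)$ with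
  $\zeta = z/x$ cannot be small: the largest weights belong to the $j$ near $r$, and the
  corresponding powers $\zeta^j$ cannot all be close to $-1$
  (lemmas \<open>weighted_cosine_gain\<close> and \<open>exp_minus_log_trunc_bound\<close>). Two integrations by
  parts make the integrand decay like $|1-z|^{-2}$ away from $1$, so that no power of $r$ is lost
  (lemma \<open>kappa_error_contour_bound\<close>).

  It remains to compare $e^{L(x)} x^{-n}$ with $\nu(n,r)$. The numbers $\nu(m,r) x^m e^{-L(x)}$ form
  a probability distribution with mean $\sum_{j \le r} x^j$ and variance $\sum_{j \le r} j x^j$. Let
  $x$ be such that the mean is $n + 2\sqrt{rn}$. Chebyshev's inequality finds at least half of the mass in a
  window just to the right of $n$, and since $\nu(m,r)$ is nonincreasing in $m$, this bounds
  $\nu(n,r)$ below (lemma \<open>nu_saddle_point_bound\<close>). The loss is $e^{O(\sqrt u \log u)}$, which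
  for $r \ge 5$ and large $u$ is negligible against the saving of order at least
  $u^{1-2/r}/\log^2 u$ in the exponent (lemma \<open>saddle_exponent_bound\<close>). Bounded $u$ is
  elementary (lemma \<open>kappa_error_bounded_ratio\<close>).

  For $2 \le r < 5$ the coefficients of $e^{-L}$ are bounded in absolute value by those of
  $e^{L}$, and $\kappa(n,r) - e^{-H_r}$ is a tail sum of the former; hence it is at most
  $\sum_{m>n} \nu(m,r) \le 2 r \nu(n,r)$ (lemma \<open>kappa_error_le_nu\<close>).
\<close>

section \<open>Permutations with prescribed cycle lengths\<close>

definition perms_with_cycles_in :: "nat set \<Rightarrow> 'a set \<Rightarrow> ('a \<Rightarrow> 'a) set" where
  "perms_with_cycles_in A X = {s. s permutes X \<and> (\<forall>C\<subseteq>X. cyclic_on s C \<longrightarrow> card C \<in> A)}"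

definition full_cycles :: "'a set \<Rightarrow> ('a \<Rightarrow> 'a) set" where
  "full_cycles B = {c. c permutes B \<and> cyclic_on c B}"

lemma finite_perms_with_cycles_in: "finite X \<Longrightarrow> finite (perms_with_cycles_in A X)"
  unfolding perms_with_cycles_in_def
  by (rule finite_subset[OF _ finite_permutations[of X]]) auto

lemma perm_restrict_orbit_permutes:
  assumes s: "s permutes X" and B: "cyclic_on s B"
  shows "perm_restrict s B permutes B"
  unfolding permutes_def
proof (intro conjI allI impI)
  have fin: "finite B" using B by (rule finite_cyclic_on)
  have sub: "s ` B \<subseteq> B" using cyclic_on_inI[OF B] by auto
  have im: "s ` B = B"
    using endo_inj_surj[OF fin sub] s by (meson inj_on_subset permutes_inj subset_UNIV)
  fix x
  show "x \<notin> B \<Longrightarrow> perm_restrict s B x = x" by (simp add: perm_restrict_simps)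
  show "\<exists>!y. perm_restrict s B y = x"
  proof (cases "x \<in> B")
    case True
    then obtain y where "y \<in> B" "s y = x" using im by (metis imageE)
    then show ?thesis using True
      by (intro ex1I[of _ y])
         (auto simp: perm_restrict_def split: if_splits dest: injD[OF permutes_inj[OF s]])
  next
    case False
    then show ?thesis
      by (intro ex1I[of _ x])
         (use sub in \<open>auto simp: perm_restrict_def split: if_splits\<close>)
  qed
qed

lemma cyclic_on_disjoint_or_equal:
  assumes "cyclic_on s B" "cyclic_on s C"
  shows "B = C \<or> B \<inter> C = {}"
  using assms by (metis cyclic_on_alldef disjoint_iff)

text \<open>
  A permutation whose orbit of $a$ is $B$ is the same thing as a cyclic permutation of $B$
  together with a permutation of the complement of $B$; the remaining cycles all live on the
  complement, so the restriction on cycle lengths passes to the second component.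
\<close>

lemma bij_betw_split_orbit:
  assumes X: "finite X" and B: "B \<subseteq> X" "a \<in> B" and A: "card B \<in> A"
  shows "bij_betw (\<lambda>s. (perm_restrict s B, perm_restrict s (X - B)))
           {s \<in> perms_with_cycles_in A X. orbit s a = B}
           (full_cycles B \<times> perms_with_cycles_in A (X - B))"
proof (rule bij_betw_byWitness[where f' = "\<lambda>(c, t). c \<circ> t"])
  have cyc: "cyclic_on s B" if "s permutes X" "orbit s a = B" for s
    using cyclic_on_orbit[OF that(1) X, of a] that by simp
  have XB: "B \<union> (X - B) = X" using B by auto
  show "\<forall>s\<in>{s \<in> perms_with_cycles_in A X. orbit s a = B}.
      (case (perm_restrict s B, perm_restrict s (X - B)) of (c, t) \<Rightarrow> c \<circ> t) = s"
  proof
    fix s assume "s \<in> {s \<in> perms_with_cycles_in A X. orbit s a = B}"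
    then have s: "s permutes X" "orbit s a = B" by (auto simp: perms_with_cycles_in_def)
    have "perm_restrict s B \<circ> perm_restrict s (X - B) = perm_restrict s (B \<union> (X - B))"
      by (rule perm_restrict_union)
         (use perm_restrict_orbit_permutes[OF s(1) cyc[OF s]]
              perm_restrict_diff_cyclic[OF s(1) cyc[OF s]] in auto)
    then show "(case (perm_restrict s B, perm_restrict s (X - B)) of (c, t) \<Rightarrow> c \<circ> t) = s"
      using s by (simp only: prod.case XB perm_restrict_id)
  qed
  show "\<forall>p\<in>full_cycles B \<times> perms_with_cycles_in A (X - B).
      (perm_restrict (case p of (c, t) \<Rightarrow> c \<circ> t) B, perm_restrict (case p of (c, t) \<Rightarrow> c \<circ> t) (X - B)) = p"
  proof
    fix p assume p: "p \<in> full_cycles B \<times> perms_with_cycles_in A (X - B)"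
    obtain c t where ct: "p = (c, t)" by (cases p)
    have c: "c permutes B" and t: "t permutes (X - B)"
      using p ct by (auto simp: full_cycles_def perms_with_cycles_in_def)
    have tB: "t x = x" if "x \<in> B" for x using permutes_not_in[OF t] that by auto
    have cB: "c x = x" if "x \<notin> B" for x using permutes_not_in[OF c that] .
    have tX: "t x \<in> X - B" if "x \<in> X - B" for x using permutes_in_image[OF t] that by simp
    have "perm_restrict (c \<circ> t) B = c"
      by (rule ext) (auto simp: perm_restrict_def tB cB)
    moreover have "perm_restrict (c \<circ> t) (X - B) = t"
      using tX cB permutes_not_in[OF t] by (intro ext) (auto simp: perm_restrict_def)
    ultimately show "(perm_restrict (case p of (c, t) \<Rightarrow> c \<circ> t) B, perm_restrict (case p of (c, t) \<Rightarrow> c \<circ> t) (X - B)) = p"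
      by (simp add: ct)
  qed
  show "(\<lambda>s. (perm_restrict s B, perm_restrict s (X - B))) `
      {s \<in> perms_with_cycles_in A X. orbit s a = B}
      \<subseteq> full_cycles B \<times> perms_with_cycles_in A (X - B)"
  proof
    fix p assume "p \<in> (\<lambda>s. (perm_restrict s B, perm_restrict s (X - B))) `
      {s \<in> perms_with_cycles_in A X. orbit s a = B}"
    then obtain s where p: "p = (perm_restrict s B, perm_restrict s (X - B))"
      and s: "s permutes X" "orbit s a = B"
      and good: "\<And>C. C \<subseteq> X \<Longrightarrow> cyclic_on s C \<Longrightarrow> card C \<in> A"
      by (auto simp: perms_with_cycles_in_def)
    have "perm_restrict s B \<in> full_cycles B"
      using perm_restrict_orbit_permutes[OF s(1) cyc[OF s]] cyc[OF s]
      by (simp add: full_cycles_def cyclic_on_perm_restrict)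
    moreover have "card C \<in> A" if "C \<subseteq> X - B" "cyclic_on (perm_restrict s (X - B)) C" for C
    proof -
      have "cyclic_on s C = cyclic_on (perm_restrict s (X - B)) C"
        by (rule cyclic_cong) (use that in \<open>auto simp: perm_restrict_def\<close>)
      then show ?thesis using that good[of C] by auto
    qed
    then have "perm_restrict s (X - B) \<in> perms_with_cycles_in A (X - B)"
      using perm_restrict_diff_cyclic[OF s(1) cyc[OF s]]
      by (simp add: perms_with_cycles_in_def)
    ultimately show "p \<in> full_cycles B \<times> perms_with_cycles_in A (X - B)"
      by (simp add: p)
  qed
  show "(\<lambda>(c, t). c \<circ> t) ` (full_cycles B \<times> perms_with_cycles_in A (X - B))
      \<subseteq> {s \<in> perms_with_cycles_in A X. orbit s a = B}"
  proof clarify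
    fix c t assume "c \<in> full_cycles B" and "t \<in> perms_with_cycles_in A (X - B)"
    then have c: "c permutes B" "cyclic_on c B" and t: "t permutes (X - B)"
      and good: "\<And>C. C \<subseteq> X - B \<Longrightarrow> cyclic_on t C \<Longrightarrow> card C \<in> A"
      by (auto simp: full_cycles_def perms_with_cycles_in_def)
    have perm: "c \<circ> t permutes X"
      by (rule permutes_compose) (use c t B in \<open>auto intro: permutes_subset\<close>)
    have cB: "cyclic_on (c \<circ> t) B"
      by (rule permutes_comp_preserves_cyclic1[OF t c(2), of B]) auto
    have "card C \<in> A" if C: "C \<subseteq> X" "cyclic_on (c \<circ> t) C" for C
    proof -
      consider "C = B" | "B \<inter> C = {}" using cyclic_on_disjoint_or_equal[OF cB C(2)] by blast
      then show ?thesis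
      proof cases
        case 1 then show ?thesis using A by simp
      next
        case 2
        have "cyclic_on (c \<circ> t) C = cyclic_on t C"
        proof (rule cyclic_cong)
          fix x assume "x \<in> C"
          then have "x \<in> X - B" using C 2 by auto
          then have "t x \<in> X - B" using permutes_in_image[OF t] by simp
          then show "(c \<circ> t) x = t x" using permutes_not_in[OF c(1)] by simp
        qed
        then show ?thesis using good[of C] C 2 by auto
      qed
    qed
    with perm show "c \<circ> t \<in> perms_with_cycles_in A X \<and> orbit (c \<circ> t) a = B"
      using orbit_cyclic_eq3[OF cB B(2)] by (auto simp: perms_with_cycles_in_def)
  qed
qed

lemma card_perms_with_cycles_in:
  fixes X :: "'a set"
  assumes X: "finite X" and a: "a \<in> X"
  shows "card (perms_with_cycles_in A X) =
    (\<Sum>B \<in> {B. a \<in> B \<and> B \<subseteq> X \<and> card B \<in> A}.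
        card (full_cycles B) * card (perms_with_cycles_in A (X - B)))"
proof -
  let ?I = "{B. a \<in> B \<and> B \<subseteq> X \<and> card B \<in> A}"
  let ?F = "\<lambda>B. {s \<in> perms_with_cycles_in A X. orbit s a = B}"
  have fin: "finite ?I" using X by (intro finite_subset[OF _ finite_Pow_iff[THEN iffD2, OF X]]) auto
  have "perms_with_cycles_in A X = (\<Union>B\<in>?I. ?F B)"
  proof (intro equalityI subsetI)
    fix s assume s: "s \<in> perms_with_cycles_in A X"
    then have p: "s permutes X" by (simp add: perms_with_cycles_in_def)
    have "orbit s a \<subseteq> X" using permutes_orbit_subset[OF p a] .
    moreover have "cyclic_on s (orbit s a)" using cyclic_on_orbit[OF p X] .
    moreover have "a \<in> orbit s a"
      using p X permutation_permutes permutation_self_in_orbit by metis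
    ultimately have "orbit s a \<in> ?I" using s by (auto simp: perms_with_cycles_in_def)
    then show "s \<in> (\<Union>B\<in>?I. ?F B)" using s by auto
  qed auto
  then have "card (perms_with_cycles_in A X) = card (\<Union>B\<in>?I. ?F B)" by simp
  also have "\<dots> = (\<Sum>B\<in>?I. card (?F B))"
    by (rule card_UN_disjoint) (use fin X finite_perms_with_cycles_in[OF X] in auto)
  also have "\<dots> = (\<Sum>B\<in>?I. card (full_cycles B) * card (perms_with_cycles_in A (X - B)))"
  proof (rule sum.cong[OF refl])
    fix B assume "B \<in> ?I"
    then show "card (?F B) = card (full_cycles B) * card (perms_with_cycles_in A (X - B))"
      using bij_betw_same_card[OF bij_betw_split_orbit[OF X, of B a A]]
      by (simp add: card_cartesian_product)
  qed
  finally show ?thesis .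
qed

text \<open>
  Sorting the sets by cardinality: a $j$-element subset containing $a$ is determined by its
  other $j - 1$ elements.
\<close>

lemma sum_over_subsets_containing:
  fixes g :: "nat \<Rightarrow> real"
  assumes X: "finite X" and a: "a \<in> X"
  shows "(\<Sum>B \<in> {B. a \<in> B \<and> B \<subseteq> X \<and> card B \<in> A}. g (card B)) =
     (\<Sum>j \<in> {1..card X} \<inter> A. real ((card X - 1) choose (j - 1)) * g j)"
proof -
  let ?I = "{B. a \<in> B \<and> B \<subseteq> X \<and> card B \<in> A}"
  have fin: "finite ?I" using X by (intro finite_subset[OF _ finite_Pow_iff[THEN iffD2, OF X]]) auto
  have sub: "card ` ?I \<subseteq> {1..card X} \<inter> A"
  proof (rule image_subsetI)
    fix B assume "B \<in> ?I"
    then have B: "a \<in> B" "B \<subseteq> X" "card B \<in> A" by auto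
    have "finite B" using B X finite_subset by blast
    then show "card B \<in> {1..card X} \<inter> A" using B X card_mono[of X B] card_gt_0_iff[of B] by auto
  qed
  have "(\<Sum>B\<in>?I. g (card B)) = (\<Sum>j\<in>{1..card X} \<inter> A. \<Sum>B\<in>{B \<in> ?I. card B = j}. g (card B))"
    by (rule sum.group[symmetric]) (use fin sub in auto)
  also have "\<dots> = (\<Sum>j \<in> {1..card X} \<inter> A. real ((card X - 1) choose (j - 1)) * g j)"
  proof (rule sum.cong[OF refl])
    fix j assume j: "j \<in> {1..card X} \<inter> A"
    have "bij_betw (insert a) {C. C \<subseteq> X - {a} \<and> card C = j - 1} {B \<in> ?I. card B = j}"
    proof (rule bij_betw_byWitness[where f' = "\<lambda>B. B - {a}"])
      show "\<forall>C\<in>{C. C \<subseteq> X - {a} \<and> card C = j - 1}. insert a C - {a} = C" by auto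
      show "\<forall>B\<in>{B \<in> ?I. card B = j}. insert a (B - {a}) = B" by auto
      show "insert a ` {C. C \<subseteq> X - {a} \<and> card C = j - 1} \<subseteq> {B \<in> ?I. card B = j}"
      proof (rule image_subsetI)
        fix C assume "C \<in> {C. C \<subseteq> X - {a} \<and> card C = j - 1}"
        then have C: "C \<subseteq> X - {a}" "card C = j - 1" by auto
        then have "finite C" using X finite_subset by blast
        then have "card (insert a C) = Suc (j - 1)" using C by (subst card_insert_disjoint) auto
        then have "card (insert a C) = j" using j by auto
        then show "insert a C \<in> {B \<in> ?I. card B = j}"
          using C a j by auto
      qed
      show "(\<lambda>B. B - {a}) ` {B \<in> ?I. card B = j} \<subseteq> {C. C \<subseteq> X - {a} \<and> card C = j - 1}"
        by auto
    qed
    from bij_betw_same_card[OF this, symmetric]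
    have "card {B \<in> ?I. card B = j} = card {C. C \<subseteq> X - {a} \<and> card C = j - 1}" .
    also have "\<dots> = (card X - 1) choose (j - 1)"
      using n_subsets[of "X - {a}" "j - 1"] X a by simp
    finally show "(\<Sum>B\<in>{B \<in> ?I. card B = j}. g (card B)) = real ((card X - 1) choose (j - 1)) * g j"
      by simp
  qed
  finally show ?thesis .
qed

lemma binomial_times_facts:
  assumes "1 \<le> j" "j \<le> n"
  shows "real ((n - 1) choose (j - 1)) * (fact (j - 1) * fact (n - j)) = fact (n - 1)"
proof -
  have "n - 1 - (j - 1) = n - j" using assms by auto
  then show ?thesis
    using binomial_fact[of "j - 1" "n - 1", where 'a=real] assms by (simp add: field_simps)
qed

text \<open>
  The number of full cycles follows from the decomposition by the orbit of $a$, applied to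
  all permutations. Each orbit size $j < n$ contributes
  ${n-1 \choose j-1} (j-1)! (n-j)! = (n-1)!$ by induction, there are $n!$ permutations in
  all, and so $(n-1)!$ of them are left for $j = n$.
\<close>

lemma card_full_cycles:
  assumes "finite X" "X \<noteq> {}"
  shows "card (full_cycles X) = fact (card X - 1)"
  using assms
proof (induction "card X" arbitrary: X rule: less_induct)
  case less
  then obtain a where a: "a \<in> X" by auto
  let ?n = "card X"
  let ?I = "{B. a \<in> B \<and> B \<subseteq> X \<and> card B \<in> UNIV}"
  have n: "?n \<ge> 1" using less.prems card_gt_0_iff[of X] by auto
  have fin: "finite ?I" using less.prems by (intro finite_subset[OF _ finite_Pow_iff[THEN iffD2, of X]]) auto
  have all: "card (perms_with_cycles_in UNIV Y) = fact (card Y)" if "finite Y" for Y :: "'a set"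
    using card_permutations[OF refl that] by (simp add: perms_with_cycles_in_def)
  have fX: "fact ?n = (\<Sum>B\<in>?I. card (full_cycles B) * fact (card (X - B)))"
    using card_perms_with_cycles_in[OF less.prems(1) a, of UNIV] less.prems all by simp
  have "(\<Sum>B\<in>?I. card (full_cycles B) * fact (card (X - B)))
      = card (full_cycles X) + (\<Sum>B\<in>?I-{X}. card (full_cycles B) * fact (card (X - B)))"
    using fin a by (subst sum.remove[of _ X]) auto
  \<comment> \<open>The proper subsets are covered by the induction hypothesis.\<close>
  also have "(\<Sum>B\<in>?I-{X}. card (full_cycles B) * fact (card (X - B))) =
      (\<Sum>B\<in>?I-{X}. fact (card B - 1) * fact (?n - card B))"
  proof (rule sum.cong[OF refl])
    fix B assume "B \<in> ?I - {X}"
    then have B: "a \<in> B" "B \<subset> X" by auto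
    then have "finite B" "card B < card X" using less.prems psubset_card_mono finite_subset by blast+
    then show "card (full_cycles B) * fact (card (X - B)) = fact (card B - 1) * fact (?n - card B)"
      using less.hyps[of B] B less.prems by (auto simp: card_Diff_subset)
  qed
  finally have "fact ?n = card (full_cycles X) + (\<Sum>B\<in>?I-{X}. fact (card B - 1) * fact (?n - card B))"
    using fX by simp
  from arg_cong[OF this, of real]
  have 1: "fact ?n = real (card (full_cycles X)) + (\<Sum>B\<in>?I-{X}. fact (card B - 1) * fact (?n - card B))"
    by simp
  have 2: "(\<Sum>B\<in>?I. fact (card B - 1) * fact (?n - card B) :: real)
     = fact (?n - 1) + (\<Sum>B\<in>?I-{X}. fact (card B - 1) * fact (?n - card B))"
    using fin a by (subst sum.remove[of _ X]) auto
  have "(\<Sum>B\<in>?I. fact (card B - 1) * fact (?n - card B) :: real)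
     = (\<Sum>j \<in> {1..?n} \<inter> UNIV. real ((?n - 1) choose (j - 1)) * (fact (j - 1) * fact (?n - j)))"
    by (rule sum_over_subsets_containing) (use less.prems a in auto)
  also have "\<dots> = (\<Sum>j \<in> {1..?n} \<inter> UNIV. fact (?n - 1))"
  proof (rule sum.cong[OF refl])
    fix j assume j: "j \<in> {1..?n} \<inter> UNIV"
    then show "real ((?n - 1) choose (j - 1)) * (fact (j - 1) * fact (?n - j)) = fact (?n - 1)"
      by (intro binomial_times_facts) auto
  qed
  also have "\<dots> = real ?n * fact (?n - 1)" by (simp only: Int_UNIV_right sum_constant card_atLeastAtMost diff_Suc_1 add_diff_cancel_right' Suc_eq_plus1)
  also have "\<dots> = fact ?n" by (rule fact_reduce[symmetric]) (use n in simp)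
  finally have "real (card (full_cycles X)) = fact (?n - 1)"
    using 1 unfolding 2 by linarith
  then show ?case by (subst of_nat_eq_iff[where 'a=real, symmetric]) simp
qed

text \<open>
  The recursion is the one obeyed by the proportion of permutations of an $n$-set whose cycle
  lengths lie in $A$: the cycle through a fixed element is equally likely to have each of the
  lengths $1, \ldots, n$, and the rest is then a uniformly random permutation of $n - j$
  points.
\<close>

fun cycle_prob :: "nat set \<Rightarrow> nat \<Rightarrow> real" where
  "cycle_prob A n = (if n = 0 then 1 else (\<Sum>j \<in> {1..n} \<inter> A. cycle_prob A (n - j)) / real n)"

declare cycle_prob.simps [simp del]

lemma card_perms_with_cycles_in_eq:
  assumes "finite X"
  shows "real (card (perms_with_cycles_in A X)) = fact (card X) * cycle_prob A (card X)"
  using assms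
proof (induction "card X" arbitrary: X rule: less_induct)
  case less
  let ?n = "card X"
  show ?case
  proof (cases "X = {}")
    case True
    have "perms_with_cycles_in A ({}::'a set) = {id}"
      by (auto simp: perms_with_cycles_in_def cyclic_on_alldef)
    then show ?thesis using True by (simp add: cycle_prob.simps)
  next
    case False
    then obtain a where a: "a \<in> X" by auto
    have n: "?n \<ge> 1" using less.prems False card_gt_0_iff[of X] by auto
    let ?I = "{B. a \<in> B \<and> B \<subseteq> X \<and> card B \<in> A}"
    have "real (card (perms_with_cycles_in A X)) =
       (\<Sum>B\<in>?I. real (card (full_cycles B)) * real (card (perms_with_cycles_in A (X - B))))"
      using card_perms_with_cycles_in[OF less.prems a, of A] by simp
    also have "\<dots> = (\<Sum>B\<in>?I. fact (card B - 1) * (fact (?n - card B) * cycle_prob A (?n - card B)))"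
    proof (rule sum.cong[OF refl])
      fix B assume B: "B \<in> ?I"
      then have f: "finite B" "B \<noteq> {}" using less.prems finite_subset by auto
      then have c: "card (X - B) = ?n - card B" using B by (simp add: card_Diff_subset)
      have "card B > 0" using f by (simp add: card_gt_0_iff)
      then have "card (X - B) < ?n" using c n by simp
      then have "real (card (perms_with_cycles_in A (X - B))) =
          fact (card (X - B)) * cycle_prob A (card (X - B))"
        using less.hyps[of "X - B"] less.prems by simp
      then show "real (card (full_cycles B)) * real (card (perms_with_cycles_in A (X - B)))
         = fact (card B - 1) * (fact (?n - card B) * cycle_prob A (?n - card B))"
        using card_full_cycles[OF f] c by simp
    qed
    also have "\<dots> = (\<Sum>j \<in> {1..?n} \<inter> A. real ((?n - 1) choose (j - 1)) *
        (fact (j - 1) * (fact (?n - j) * cycle_prob A (?n - j))))"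
      by (rule sum_over_subsets_containing) (use less.prems a in auto)
    also have "\<dots> = (\<Sum>j \<in> {1..?n} \<inter> A. fact (?n - 1) * cycle_prob A (?n - j))"
    proof (rule sum.cong[OF refl])
      fix j assume j: "j \<in> {1..?n} \<inter> A"
      then have "real ((?n - 1) choose (j - 1)) * (fact (j - 1) * fact (?n - j)) = fact (?n - 1)"
        by (intro binomial_times_facts) auto
      then show "real ((?n - 1) choose (j - 1)) * (fact (j - 1) * (fact (?n - j) * cycle_prob A (?n - j)))
           = fact (?n - 1) * cycle_prob A (?n - j)"
        by (simp flip: mult.assoc)
    qed
    also have "\<dots> = fact (?n - 1) * (\<Sum>j \<in> {1..?n} \<inter> A. cycle_prob A (?n - j))"
      by (rule sum_distrib_left[symmetric])
    also have "\<dots> = fact (?n - 1) * (real ?n * cycle_prob A ?n)"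
      using n by (subst (2) cycle_prob.simps) simp
    also have "\<dots> = fact ?n * cycle_prob A ?n"
      using n by (subst fact_reduce[of ?n]) (simp_all only: mult.assoc mult.left_commute mult.commute of_nat_id less_eq_Suc_le One_nat_def)
    finally show ?thesis .
  qed
qed

lemma cycle_count_eq_0_iff:
  "cycle_count n j s = 0 \<longleftrightarrow> (\<forall>C\<subseteq>{1..n}. cyclic_on s C \<longrightarrow> card C \<noteq> j)"
proof -
  have "finite {A. A \<subseteq> {1..n} \<and> cyclic_on s A \<and> card A = j}"
    by (rule finite_subset[of _ "Pow {1..n}"]) auto
  then show ?thesis by (auto simp: cycle_count_def)
qed

lemma card_cyclic_subset:
  assumes "cyclic_on s C" "C \<subseteq> {1..n::nat}"
  shows "1 \<le> card C \<and> card C \<le> n"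
proof -
  have "finite C" using assms(2) finite_subset by blast
  moreover have "C \<noteq> {}" using assms(1) by (simp add: cyclic_on_alldef)
  ultimately show ?thesis using card_mono[OF _ assms(2)] card_gt_0_iff[of C] by force
qed

lemma kappa_eq_cycle_prob: "kappa n r = cycle_prob {r<..} n"
proof -
  have "(\<forall>j. 1 \<le> j \<and> j \<le> r \<longrightarrow> cycle_count n j s = 0) \<longleftrightarrow>
      (\<forall>C\<subseteq>{1..n}. cyclic_on s C \<longrightarrow> card C \<in> {r<..})" (is "?L \<longleftrightarrow> ?R") for s
  proof
    assume L: ?L
    show ?R
    proof (intro allI impI)
      fix C assume C: "C \<subseteq> {1..n}" "cyclic_on s C"
      show "card C \<in> {r<..}"
        using L C card_cyclic_subset[OF C(2,1)] unfolding cycle_count_eq_0_iff greaterThan_iff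
        by (metis not_le)
    qed
  next
    show "?R \<Longrightarrow> ?L"
      unfolding cycle_count_eq_0_iff greaterThan_iff by (meson not_le)
  qed
  then have "{s. s permutes {1..n} \<and> (\<forall>j. 1 \<le> j \<and> j \<le> r \<longrightarrow> cycle_count n j s = 0)} =
      perms_with_cycles_in {r<..} {1..n}"
    by (simp only: perms_with_cycles_in_def)
  then show ?thesis
    using card_perms_with_cycles_in_eq[of "{1..n}" "{r<..}"] by (simp add: kappa_def)
qed

lemma nu_eq_cycle_prob: "nu n r = cycle_prob {..r} n"
proof -
  have "(\<forall>j. r + 1 \<le> j \<and> j \<le> n \<longrightarrow> cycle_count n j s = 0) \<longleftrightarrow>
      (\<forall>C\<subseteq>{1..n}. cyclic_on s C \<longrightarrow> card C \<in> {..r})" (is "?L \<longleftrightarrow> ?R") for s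
  proof
    assume L: ?L
    show ?R
    proof (intro allI impI)
      fix C assume C: "C \<subseteq> {1..n}" "cyclic_on s C"
      show "card C \<in> {..r}"
        using L C card_cyclic_subset[OF C(2,1)]
        unfolding cycle_count_eq_0_iff atMost_iff Suc_eq_plus1[symmetric] Suc_le_eq
        by (metis not_le)
    qed
  next
    show "?R \<Longrightarrow> ?L"
      unfolding cycle_count_eq_0_iff atMost_iff Suc_eq_plus1[symmetric] Suc_le_eq by (meson not_le)
  qed
  then have "{s. s permutes {1..n} \<and> (\<forall>j. r + 1 \<le> j \<and> j \<le> n \<longrightarrow> cycle_count n j s = 0)} =
      perms_with_cycles_in {..r} {1..n}"
    by (simp only: perms_with_cycles_in_def)
  then show ?thesis
    using card_perms_with_cycles_in_eq[of "{1..n}" "{..r}"] by (simp add: nu_def)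
qed

section \<open>Recurrences and elementary bounds\<close>

lemma nu_0 [simp]: "nu 0 r = 1"
  by (simp add: nu_eq_cycle_prob cycle_prob.simps)

lemma kappa_0 [simp]: "kappa 0 r = 1"
  by (simp add: kappa_eq_cycle_prob cycle_prob.simps)

lemma nu_nonneg: "0 \<le> nu n r"
  by (simp add: nu_def)

lemma kappa_nonneg: "0 \<le> kappa n r"
  by (simp add: kappa_def)

lemma nu_recurrence: "real n * nu n r = (\<Sum>i\<in>{n - r..<n}. nu i r)"
proof (cases "n = 0")
  case False
  have "real n * nu n r = (\<Sum>j \<in> {1..n} \<inter> {..r}. nu (n - j) r)"
    using False by (simp add: nu_eq_cycle_prob cycle_prob.simps[of _ n])
  also have "\<dots> = (\<Sum>i\<in>{n - r..<n}. nu i r)"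
    by (rule sum.reindex_bij_witness[of _ "\<lambda>i. n - i" "\<lambda>j. n - j"]) auto
  finally show ?thesis .
qed simp

lemma kappa_recurrence: "real n * kappa n r = (\<Sum>i<n - r. kappa i r)"
proof (cases "n = 0")
  case False
  have "real n * kappa n r = (\<Sum>j \<in> {1..n} \<inter> {r<..}. kappa (n - j) r)"
    using False by (simp add: kappa_eq_cycle_prob cycle_prob.simps[of _ n])
  also have "\<dots> = (\<Sum>i<n - r. kappa i r)"
    by (rule sum.reindex_bij_witness[of _ "\<lambda>i. n - i" "\<lambda>j. n - j"]) auto
  finally show ?thesis .
qed simp

lemma kappa_step:
  "real (Suc m) * kappa (Suc m) r = real m * kappa m r + (if r \<le> m then kappa (m - r) r else 0)"
  unfolding kappa_recurrence by (simp add: Suc_diff_le)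

text \<open>
  Passing from $m$ to $m + 1$ the window of summation in the recurrence gains the term
  $\nu(m)$ and possibly loses one, so that $(m+1)\nu(m+1) \le m\nu(m) + \nu(m)$.
\<close>

lemma nu_antimono_step:
  assumes "r \<ge> 1"
  shows "nu (Suc m) r \<le> nu m r"
proof -
  have "real (Suc m) * nu (Suc m) r \<le> real (Suc m) * nu m r"
  proof -
    have "(\<Sum>i\<in>{Suc m - r..<Suc m}. nu i r) = nu m r + (\<Sum>i\<in>{Suc m - r..<m}. nu i r)"
      using assms by (simp add: sum.atLeastLessThan_Suc)
    also have "(\<Sum>i\<in>{Suc m - r..<m}. nu i r) \<le> (\<Sum>i\<in>{m - r..<m}. nu i r)"
      by (rule sum_mono2) (auto simp: nu_nonneg)
    finally show ?thesis unfolding nu_recurrence by (simp add: algebra_simps nu_recurrence)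
  qed
  then show ?thesis by (rule mult_left_le_imp_le) simp
qed

lemma nu_antimono:
  assumes "r \<ge> 1" "m \<le> n"
  shows "nu n r \<le> nu m r"
  using assms(2) by (rule lift_Suc_antimono_le[of "\<lambda>n. nu n r", OF nu_antimono_step[OF assms(1)]])

lemma nu_eq_1:
  assumes "n \<le> r"
  shows "nu n r = 1"
  using assms
proof (induction n rule: less_induct)
  case (less n)
  then have "real n * nu n r = real n"
    by (simp add: nu_recurrence)
  then show ?case using nu_0 by (cases "n = 0") auto
qed

lemma nu_shift_upper:
  assumes "r \<ge> 1" "r \<le> n"
  shows "real n * nu n r \<le> real r * nu (n - r) r"
proof -
  have "(\<Sum>i\<in>{n - r..<n}. nu i r) \<le> (\<Sum>i\<in>{n - r..<n}. nu (n - r) r)"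
    by (rule sum_mono) (use assms in \<open>auto intro: nu_antimono\<close>)
  then show ?thesis using assms unfolding nu_recurrence by simp
qed

lemma nu_shift_lower:
  assumes "1 \<le> h" "h \<le> r" "r \<le> n"
  shows "(real r - real h + 1) * nu (n - h) r \<le> real n * nu n r"
proof -
  have "(\<Sum>i\<in>{n - r..n - h}. nu (n - h) r) \<le> (\<Sum>i\<in>{n - r..n - h}. nu i r)"
    by (rule sum_mono) (use assms in \<open>auto intro: nu_antimono\<close>)
  also have "\<dots> \<le> (\<Sum>i\<in>{n - r..<n}. nu i r)"
    by (rule sum_mono2) (use assms in \<open>auto simp: nu_nonneg\<close>)
  finally show ?thesis using assms unfolding nu_recurrence
    by (simp add: of_nat_diff Suc_diff_le algebra_simps)
qed

text \<open>
  Only the terms at distance at least $h = \lceil r/2 \rceil$ in the recurrence are kept. By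
  monotonicity each of them is at least $\nu(n-h)$, and there are about $r/2$ of them, so a
  step back by $h$ costs a factor of at most $2n/r \le 2U$.
\<close>

lemma nu_lower_bound_iter:
  assumes U: "U \<ge> 1" and r: "r \<ge> 1" and n: "real n \<le> U * real r"
    and k: "n \<le> r + k * ((r + 1) div 2)"
  shows "nu n r \<ge> (1 / (2 * U)) ^ k"
  using n k
proof (induction k arbitrary: n)
  case 0
  then show ?case by (simp add: nu_eq_1)
next
  case (Suc k)
  let ?h = "(r + 1) div 2"
  show ?case
  proof (cases "n \<le> r")
    case True
    have "(1 / (2 * U)) ^ Suc k \<le> 1" using U by (intro power_le_one) auto
    then show ?thesis using True by (simp add: nu_eq_1)
  next
    case False
    have h12: "1 \<le> ?h" "?h \<le> r" "2 * ?h \<le> r + 1" using r by auto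
    from h12(3) have "real (2 * ?h) \<le> real (r + 1)" by (rule of_nat_mono)
    then have h: "1 \<le> ?h" "?h \<le> r" "real ?h \<le> (real r + 1) / 2" using h12 by auto
    have IH: "nu (n - ?h) r \<ge> (1 / (2 * U)) ^ k"
      using Suc.prems by (intro Suc.IH) auto
    have "real r / 2 * (1 / (2 * U)) ^ k \<le> (real r - real ?h + 1) * nu (n - ?h) r"
      using h U by (intro mult_mono IH) auto
    also have "\<dots> \<le> real n * nu n r" using nu_shift_lower[OF h(1,2), of n] False by simp
    also have "\<dots> \<le> U * real r * nu n r" using Suc.prems nu_nonneg by (intro mult_right_mono)
    finally have "real r * ((1 / (2 * U)) ^ k / 2) \<le> real r * (U * nu n r)"
      by (simp add: field_simps)
    then have "(1 / (2 * U)) ^ k / 2 \<le> U * nu n r"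
      using r by (subst (asm) mult_le_cancel_left_pos) auto
    then show ?thesis using U by (simp add: field_simps)
  qed
qed

lemma nu_lower_bound_bounded_ratio:
  assumes U: "U \<ge> 1"
  shows "\<exists>c>0. \<forall>n r. r \<ge> 1 \<longrightarrow> real n \<le> U * real r \<longrightarrow> c \<le> nu n r"
proof (intro exI conjI allI impI)
  let ?k = "nat \<lceil>2 * U\<rceil>"
  show "0 < (1 / (2 * U)) ^ ?k" using U by simp
  fix n r :: nat assume r: "r \<ge> 1" and n: "real n \<le> U * real r"
  have "U * real r \<le> real ?k * (real r / 2)"
    using mult_right_mono[of "2 * U" "real ?k" "real r / 2"] U by (simp add: of_nat_ceiling)
  also have "\<dots> \<le> real ?k * real ((r + 1) div 2)"
  proof (intro mult_left_mono)
    have "r \<le> 2 * ((r + 1) div 2)" by presburger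
    then have "real r \<le> real (2 * ((r + 1) div 2))" by (rule of_nat_mono)
    then show "real r / 2 \<le> real ((r + 1) div 2)" by simp
  qed simp
  finally have "real n \<le> real (?k * ((r + 1) div 2))" using n by simp
  then have "n \<le> r + ?k * ((r + 1) div 2)" unfolding of_nat_le_iff by simp
  then show "(1 / (2 * U)) ^ ?k \<le> nu n r"
    by (intro nu_lower_bound_iter U r n)
qed

text \<open>
  In the recurrence the only term that is not already bounded by $1/r$ is $\kappa(0) = 1$.
  It is paid for by the $r$ terms missing from the sum.
\<close>

lemma kappa_upper_bound:
  assumes "r \<ge> 1" "n \<ge> 1"
  shows "kappa n r \<le> 1 / real r"
  using assms(2)
proof (induction n rule: less_induct)
  case (less n)
  have "real n * kappa n r \<le> real n * (1 / real r)"
  proof (cases "r < n")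
    case False
    then show ?thesis by (simp add: kappa_recurrence)
  next
    case True
    have "(\<Sum>i<n - r. kappa i r) = 1 + (\<Sum>i\<in>{1..<n - r}. kappa i r)"
      using True by (simp add: lessThan_atLeast0 sum.atLeast_Suc_lessThan[of 0])
    also have "(\<Sum>i\<in>{1..<n - r}. kappa i r) \<le> (\<Sum>i\<in>{1..<n - r}. 1 / real r)"
      using less.IH by (intro sum_mono) auto
    also have "1 + (\<Sum>i\<in>{1..<n - r}. 1 / real r) \<le> real n * (1 / real r)"
      using True assms(1) by (simp add: field_simps of_nat_diff)
    finally show ?thesis by (simp add: kappa_recurrence)
  qed
  then show ?case by (rule mult_left_le_imp_le) (use less.prems in simp)
qed

text \<open>
  The coefficient of $z^m$ in $\exp(-\sum_{j \le r} z^j/j)$. The sums of these coefficients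
  are the $\kappa(m)$, since $\sum_m \kappa(m) z^m$ is this function divided by $1 - z$.
\<close>

definition kappa_increment :: "nat \<Rightarrow> nat \<Rightarrow> real" where
  "kappa_increment r m = (if m = 0 then 1 else kappa m r - kappa (m - 1) r)"

lemma sum_kappa_increment: "(\<Sum>i<Suc m. kappa_increment r i) = kappa m r"
  by (induction m) (auto simp: kappa_increment_def)

lemma kappa_increment_recurrence:
  assumes "m \<ge> 1"
  shows "real m * kappa_increment r m = - (\<Sum>i\<in>{m - r..<m}. kappa_increment r i)"
proof -
  obtain k where m: "m = Suc k" using assms by (cases m) auto
  have "(\<Sum>i\<in>{m - r..<m}. kappa_increment r i) = kappa k r - (if r \<le> k then kappa (k - r) r else 0)"
  proof (cases "r \<le> k")
    case True
    have "(\<Sum>i<Suc k. kappa_increment r i) =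
       (\<Sum>i<Suc (k - r). kappa_increment r i) + (\<Sum>i\<in>{Suc (k - r)..<Suc k}. kappa_increment r i)"
      unfolding lessThan_atLeast0 by (rule sum.atLeastLessThan_concat[symmetric]) auto
    then show ?thesis unfolding sum_kappa_increment using True m by (simp add: Suc_diff_le)
  next
    case False
    then show ?thesis using sum_kappa_increment[of r k] m by (simp add: lessThan_atLeast0)
  qed
  then show ?thesis using kappa_step[of k r]
    by (simp add: m kappa_increment_def algebra_simps)
qed

text \<open>
  The recurrence for the increments is the one for $\nu$ with the sign of the right-hand
  side changed, so $\nu$ is a majorant.
\<close>

lemma abs_kappa_increment_le_nu: "\<bar>kappa_increment r m\<bar> \<le> nu m r"
proof (induction m rule: less_induct)
  case (less m)
  show ?case
  proof (cases "m = 0")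
    case True then show ?thesis by (simp add: kappa_increment_def)
  next
    case False
    have "real m * \<bar>kappa_increment r m\<bar> = \<bar>\<Sum>i\<in>{m - r..<m}. kappa_increment r i\<bar>"
      using kappa_increment_recurrence[of m r] False by (metis abs_minus_cancel abs_mult abs_of_nat less_one not_le)
    also have "\<dots> \<le> (\<Sum>i\<in>{m - r..<m}. nu i r)"
      by (rule order_trans[OF sum_abs sum_mono]) (use less.IH in auto)
    finally have "real m * \<bar>kappa_increment r m\<bar> \<le> real m * nu m r" by (simp add: nu_recurrence)
    then show ?thesis by (rule mult_left_le_imp_le) (use False in simp)
  qed
qed

text \<open>
  Let $T$ be the sum. Its first $r$ terms are at most $\nu(n)$ each, and for $m > n + r$ one
  has $\nu(m) \le (r/m) \nu(m-r) \le \nu(m-r)/2$. Hence $T \le r \nu(n) + T/2$.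
\<close>

lemma nu_tail_sum:
  assumes "r \<ge> 1" "r < n"
  shows "(\<Sum>m\<in>{n<..N}. nu m r) \<le> 2 * real r * nu n r"
proof -
  let ?T = "\<Sum>m\<in>{n<..N}. nu m r"
  have "?T = (\<Sum>m\<in>{n<..N} \<inter> {..n + r}. nu m r) + (\<Sum>m\<in>{n<..N} - {..n + r}. nu m r)"
    by (rule sum.Int_Diff) auto
  also have "(\<Sum>m\<in>{n<..N} \<inter> {..n + r}. nu m r) \<le> (\<Sum>m\<in>{n<..n + r}. nu m r)"
    by (rule sum_mono2) (auto simp: nu_nonneg)
  also have "(\<Sum>m\<in>{n<..n + r}. nu m r) \<le> (\<Sum>m\<in>{n<..n + r}. nu n r)"
    by (rule sum_mono) (use assms in \<open>auto intro: nu_antimono\<close>)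
  also have "(\<Sum>m\<in>{n<..N} - {..n + r}. nu m r) \<le> (\<Sum>m\<in>{n<..N} - {..n + r}. nu (m - r) r / 2)"
  proof (rule sum_mono)
    fix m assume m: "m \<in> {n<..N} - {..n + r}"
    have "2 * real r * nu m r \<le> real m * nu m r"
      using m assms by (intro mult_right_mono nu_nonneg) auto
    also have "\<dots> \<le> real r * nu (m - r) r" using m assms by (intro nu_shift_upper) auto
    finally show "nu m r \<le> nu (m - r) r / 2" using assms by (simp add: field_simps)
  qed
  also have "(\<Sum>m\<in>{n<..N} - {..n + r}. nu (m - r) r / 2) = (\<Sum>m\<in>(\<lambda>m. m - r) ` ({n<..N} - {..n + r}). nu m r / 2)"
    by (subst sum.reindex) (auto simp: inj_on_def)
  also have "\<dots> \<le> (\<Sum>m\<in>{n<..N}. nu m r / 2)"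
    by (rule sum_mono2) (auto simp: nu_nonneg)
  also have "\<dots> = ?T / 2" by (simp add: sum_divide_distrib)
  finally show ?thesis by simp
qed

lemma kappa_diff_le_nu:
  assumes "r \<ge> 1" "r < n" "n \<le> N"
  shows "\<bar>kappa N r - kappa n r\<bar> \<le> 2 * real r * nu n r"
proof -
  have "(\<Sum>i<Suc N. kappa_increment r i) =
       (\<Sum>i<Suc n. kappa_increment r i) + (\<Sum>i\<in>{Suc n..<Suc N}. kappa_increment r i)"
    unfolding lessThan_atLeast0 by (rule sum.atLeastLessThan_concat[symmetric]) (use assms in auto)
  moreover have "{Suc n..<Suc N} = {n<..N}" by auto
  ultimately have "kappa N r - kappa n r = (\<Sum>i\<in>{n<..N}. kappa_increment r i)"
    by (simp only: sum_kappa_increment)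
  then have "\<bar>kappa N r - kappa n r\<bar> \<le> (\<Sum>i\<in>{n<..N}. \<bar>kappa_increment r i\<bar>)"
    using sum_abs[of "kappa_increment r"] by simp
  also have "\<dots> \<le> (\<Sum>i\<in>{n<..N}. nu i r)" by (intro sum_mono abs_kappa_increment_le_nu)
  also have "\<dots> \<le> 2 * real r * nu n r" by (rule nu_tail_sum[OF assms(1,2)])
  finally show ?thesis .
qed

section \<open>Generating functions and contour integrals\<close>

text \<open>
  The logarithm of the generating function of $\nu$, denoted by $L$ in the explanations.
\<close>

definition log_trunc :: "nat \<Rightarrow> complex \<Rightarrow> complex" where
  "log_trunc r z = (\<Sum>j=1..r. z ^ j / of_nat j)"

lemma log_trunc_0 [simp]: "log_trunc r 0 = 0"
  by (auto simp: log_trunc_def intro!: sum.neutral)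

lemma log_trunc_of_real: "log_trunc r (of_real x) = of_real (\<Sum>j=1..r. x ^ j / real j)"
  by (simp add: log_trunc_def)

lemma log_trunc_1: "log_trunc r 1 = of_real (harm r)"
  by (simp add: log_trunc_def harm_def inverse_eq_divide)

lemma has_field_derivative_log_trunc:
  "(log_trunc r has_field_derivative (\<Sum>j<r. z ^ j)) (at z within A)"
proof -
  have "((\<lambda>z. \<Sum>j=1..r. z ^ j / of_nat j) has_field_derivative
      (\<Sum>j=1..r. of_nat j * z ^ (j - 1) / of_nat j)) (at z within A)"
    by (auto intro!: derivative_eq_intros)
  also have "(\<Sum>j=1..r. of_nat j * z ^ (j - 1) / of_nat j) = (\<Sum>j=1..r. z ^ (j - 1))"
    by (intro sum.cong) auto
  also have "\<dots> = (\<Sum>j<r. z ^ j)"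
    by (rule sum.reindex_bij_witness[of _ Suc "\<lambda>j. j - 1"]) auto
  finally show ?thesis by (simp add: log_trunc_def[abs_def])
qed

lemma holomorphic_log_trunc [holomorphic_intros]: "log_trunc r holomorphic_on A"
  using has_field_derivative_log_trunc field_differentiable_def holomorphic_on_def by blast

text \<open>
  The function $f = \exp(L)$ solves $f' = (1 + z + \cdots + z^{r-1}) f$, and comparing
  coefficients in this equation gives the recurrence of $\nu$.
\<close>

lemma exp_log_trunc_has_fps_expansion:
  "(\<lambda>z. exp (log_trunc r z)) has_fps_expansion Abs_fps (\<lambda>n. of_real (nu n r))"
proof -
  let ?f = "\<lambda>z. exp (log_trunc r z)"
  define F where "F = fps_expansion ?f 0"
  have F: "?f has_fps_expansion F"
    unfolding F_def
    by (rule has_fps_expansion_fps_expansion[of UNIV]) (auto intro!: holomorphic_intros)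
  have "deriv ?f z = (\<Sum>j<r. z ^ j) * ?f z" for z
    by (rule DERIV_imp_deriv)
       (auto intro!: derivative_eq_intros has_field_derivative_log_trunc)
  then have deriv: "deriv ?f = (\<lambda>z. (\<Sum>j<r. z ^ j) * ?f z)" by blast
  have "deriv ?f has_fps_expansion fps_deriv F"
    by (intro has_fps_expansion_deriv F)
  moreover have "deriv ?f has_fps_expansion (\<Sum>j<r. fps_X ^ j) * F"
    unfolding deriv by (intro fps_expansion_intros F)
  ultimately have ode: "fps_deriv F = (\<Sum>j<r. fps_X ^ j) * F"
    by (rule fps_expansion_unique_complex)
  have "fps_nth F n = of_real (nu n r)" for n
  proof (induction n rule: less_induct)
    case (less n)
    show ?case
    proof (cases n)
      case 0
      have "fps_nth F 0 = ?f 0" using F by (rule has_fps_expansion_imp_0_eq_fps_nth_0[symmetric])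
      then show ?thesis by (simp add: 0)
    next
      case (Suc m)
      have c: "fps_nth (\<Sum>j<r. fps_X ^ j) i = (if i < r then 1 else 0 :: complex)" for i
        by (simp add: fps_sum_nth)
      have "of_nat n * fps_nth F n = fps_nth (fps_deriv F) m" by (simp add: Suc)
      also have "\<dots> = (\<Sum>i=0..m. (if i < r then 1 else 0) * fps_nth F (m - i))"
        by (simp add: ode fps_mult_nth c)
      also have "\<dots> = (\<Sum>i\<in>{i\<in>{0..m}. i < r}. fps_nth F (m - i))"
        by (intro sum.mono_neutral_cong_right) auto
      also have "\<dots> = (\<Sum>i\<in>{n - r..<n}. fps_nth F i)"
        by (rule sum.reindex_bij_witness[of _ "\<lambda>i. m - i" "\<lambda>i. m - i"]) (auto simp: Suc)
      also have "\<dots> = (\<Sum>i\<in>{n - r..<n}. of_real (nu i r))"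
        by (intro sum.cong) (use less.IH in auto)
      also have "\<dots> = of_nat n * of_real (nu n r)"
        by (simp flip: of_real_sum nu_recurrence)
      finally show ?thesis using Suc by (simp del: of_nat_Suc)
    qed
  qed
  then have "F = Abs_fps (\<lambda>n. of_real (nu n r))" by (simp add: fps_eq_iff)
  then show ?thesis using F by simp
qed

lemma nu_sums: "(\<lambda>n. nu n r * x ^ n) sums exp (\<Sum>j=1..r. x ^ j / real j)"
proof -
  have "(\<lambda>n. fps_nth (Abs_fps (\<lambda>n. complex_of_real (nu n r))) n * (of_real x) ^ n) sums
      exp (log_trunc r (of_real x))"
    by (rule has_fps_expansion_imp_sums_complex[where r = \<infinity>])
       (auto intro!: exp_log_trunc_has_fps_expansion holomorphic_intros)
  then have "(\<lambda>n. complex_of_real (nu n r * x ^ n)) sums of_real (exp (\<Sum>j=1..r. x ^ j / real j))"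
    unfolding log_trunc_of_real exp_of_real by simp
  then show ?thesis unfolding sums_of_real_iff .
qed

text \<open>
  Up to the factor $2\pi i$ this is the coefficient of $z^N$ in the Laurent expansion of
  $e^{-L(z)} (1-z)^{-k}$ outside the unit disc. For $k = 1$ the function is the generating
  function of $\kappa$; crossing the pole at $1$ subtracts its residue there, which is why
  the outer expansion has the coefficients $\kappa(N) - e^{-H_r}$.
\<close>

definition error_integral :: "nat \<Rightarrow> real \<Rightarrow> nat \<Rightarrow> int \<Rightarrow> complex" where
  "error_integral r x k N = contour_integral (circlepath 0 x)
     (\<lambda>z. exp (- log_trunc r z) * z powi (- N - 1) / (1 - z) ^ k)"

context
  fixes x :: real and r :: nat
  assumes x: "x > 1" and r: "r \<ge> 1"
begin

lemma sphere_avoids_0_1: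
  fixes z :: complex
  shows "z \<in> sphere 0 x \<Longrightarrow> z \<noteq> 0 \<and> z \<noteq> 1"
proof -
  assume "z \<in> sphere 0 x"
  then have "cmod z = x" by simp
  then show ?thesis using x by auto
qed

lemma error_integrand_integrable:
  "(\<lambda>z. exp (- log_trunc r z) * z powi N / (1 - z) ^ k) contour_integrable_on (circlepath 0 x)"
proof (rule contour_integrable_continuous_circlepath)
  have "(\<lambda>z. exp (- log_trunc r z) * z powi N / (1 - z) ^ k) holomorphic_on (- {0, 1})"
    by (auto intro!: holomorphic_intros)
  then show "continuous_on (path_image (circlepath 0 x))
      (\<lambda>z. exp (- log_trunc r z) * z powi N / (1 - z) ^ k)"
    by (rule holomorphic_on_imp_continuous_on[OF holomorphic_on_subset]) (use x in auto)
qed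

lemma error_integral_diff:
  "error_integral r x (Suc k) N - error_integral r x (Suc k) (N - 1) = error_integral r x k N"
proof -
  have "error_integral r x (Suc k) N - error_integral r x (Suc k) (N - 1) =
     contour_integral (circlepath 0 x) (\<lambda>z. exp (- log_trunc r z) * z powi (- N - 1) / (1 - z) ^ Suc k
        - exp (- log_trunc r z) * z powi (- (N - 1) - 1) / (1 - z) ^ Suc k)"
    unfolding error_integral_def
    by (intro contour_integral_diff[symmetric] error_integrand_integrable)
  also have "\<dots> = error_integral r x k N"
    unfolding error_integral_def
  proof (rule contour_integral_eq)
    fix z assume "z \<in> path_image (circlepath 0 x)"
    then have z: "z \<noteq> 0" "z \<noteq> 1" using x sphere_avoids_0_1[of z] by auto
    have p: "z powi (- (N - 1) - 1) = z powi (- N - 1) * z"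
      using power_int_add_1[of z "- N - 1"] z by simp
    show "exp (- log_trunc r z) * z powi (- N - 1) / (1 - z) ^ Suc k
        - exp (- log_trunc r z) * z powi (- (N - 1) - 1) / (1 - z) ^ Suc k
        = exp (- log_trunc r z) * z powi (- N - 1) / (1 - z) ^ k"
      unfolding p using z by (simp add: divide_simps) (simp add: algebra_simps)
  qed
  finally show ?thesis .
qed

text \<open>
  Integration by parts: the integral of the derivative of $e^{-L(z)} z^{-N} (1-z)^{-k}$ over
  the circle vanishes, and $L'(z) = (1-z^r)/(1-z)$. Every application gains a factor
  $1/N$ at the price of one more factor $1/(1-z)$.
\<close>

lemma error_integral_by_parts:
  "of_int N * error_integral r x k N =
     error_integral r x (Suc k) (N - 1 - int r) + (of_nat k - 1) * error_integral r x (Suc k) (N - 1)"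
proof -
  let ?c = "circlepath 0 x"
  let ?G = "\<lambda>z. exp (- log_trunc r z)"
  let ?F = "\<lambda>z. ?G z * z powi (- N) / (1 - z) ^ k"
  let ?F' = "\<lambda>z. ?G z * z powi (- (N - 1 - int r) - 1) / (1 - z) ^ Suc k
     + (of_nat k - 1) * (?G z * z powi (- (N - 1) - 1) / (1 - z) ^ Suc k)
     - of_int N * (?G z * z powi (- N - 1) / (1 - z) ^ k)"
  have "(?F' has_contour_integral 0) ?c"
  proof (rule Cauchy_theorem_primitive[where S = "- {0, 1}" and f = ?F])
    fix z :: complex assume "z \<in> - {0, 1}"
    then have z: "z \<noteq> 0" "z \<noteq> 1" "1 - z \<noteq> 0" by auto
    let ?p = "z powi (- N - 1)"
    have p1: "z powi (- N) = ?p * z"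
      using power_int_add_1[of z "- N - 1"] z by simp
    have p2: "z powi (- (N - 1 - int r) - 1) = ?p * z * z ^ r"
      using power_int_add[of z "- N" "int r"] z by (simp add: p1 algebra_simps)
    have p3: "z powi (- (N - 1) - 1) = ?p * z" using p1 by simp
    have s: "(\<Sum>j<r. z ^ j) = (1 - z ^ r) / (1 - z)"
      using z by (subst geometric_sum) (auto simp: field_simps)
    have 1: "((\<lambda>z. ?G z * z powi (- N)) has_field_derivative
        (?G z * (- of_int N * ?p) - (\<Sum>j<r. z ^ j) * ?G z * z powi (- N))) (at z within - {0,1})"
      using z by (auto intro!: derivative_eq_intros has_field_derivative_log_trunc simp: mult_ac)
    have 2: "((\<lambda>z. (1 - z) ^ k) has_field_derivative - (of_nat k * (1 - z) ^ (k - Suc 0))) (at z within - {0,1})"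
      by (auto intro!: derivative_eq_intros)
    have "(?F has_field_derivative
       ((?G z * (- of_int N * ?p) - (\<Sum>j<r. z ^ j) * ?G z * z powi (- N)) * (1 - z) ^ k -
         ?G z * z powi (- N) * (- (of_nat k * (1 - z) ^ (k - Suc 0)))) / ((1 - z) ^ k * (1 - z) ^ k)) (at z within - {0,1})"
      by (rule DERIV_divide[OF 1 2]) (use z in simp)
    also have "((?G z * (- of_int N * ?p) - (\<Sum>j<r. z ^ j) * ?G z * z powi (- N)) * (1 - z) ^ k -
         ?G z * z powi (- N) * (- (of_nat k * (1 - z) ^ (k - Suc 0)))) / ((1 - z) ^ k * (1 - z) ^ k) = ?F' z"
    proof -
      have q: "of_nat k * (1 - z) ^ (k - Suc 0) = of_nat k * (1 - z) ^ k / (1 - z)"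
        using z by (cases k) auto
      define w where "w = (1 - z) ^ k"
      have w: "w \<noteq> 0" using z by (simp add: w_def)
      show ?thesis
        unfolding p1 p2 p3 s q power_Suc w_def[symmetric]
        using z w by (simp add: divide_simps) (simp add: algebra_simps)
    qed
    finally show "(?F has_field_derivative ?F' z) (at z within - {0, 1})" .
  qed (use x in auto)
  moreover have "(?F' has_contour_integral
     (error_integral r x (Suc k) (N - 1 - int r) + (of_nat k - 1) * error_integral r x (Suc k) (N - 1)
       - of_int N * error_integral r x k N)) ?c"
    unfolding error_integral_def
    by (intro has_contour_integral_diff has_contour_integral_add has_contour_integral_lmul
          has_contour_integral_integral error_integrand_integrable)
  ultimately have "error_integral r x (Suc k) (N - 1 - int r) + (of_nat k - 1) * error_integral r x (Suc k) (N - 1)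
       - of_int N * error_integral r x k N = 0"
    using has_contour_integral_unique by blast
  then show ?thesis by simp
qed

lemma error_integral_1_negative:
  "error_integral r x 1 (- 1 - int i) = - (2 * pi * \<i> * complex_of_real (exp (- harm r)))"
proof -
  have "((\<lambda>z. (exp (- log_trunc r z) * z ^ i) / (z - 1)) has_contour_integral
      (2 * of_real pi * \<i> * (exp (- log_trunc r 1) * 1 ^ i))) (circlepath 0 x)"
    by (rule Cauchy_integral_circlepath_simple) (use x in \<open>auto intro!: holomorphic_intros\<close>)
  from contour_integral_unique[OF has_contour_integral_neg[OF this]]
  have "contour_integral (circlepath 0 x) (\<lambda>z. - (exp (- log_trunc r z) * z ^ i / (z - 1)))
      = - (2 * pi * \<i> * complex_of_real (exp (- harm r)))"
    by (simp add: log_trunc_1 exp_of_real flip: of_real_minus)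
  moreover have "error_integral r x 1 (- 1 - int i) =
     contour_integral (circlepath 0 x) (\<lambda>z. - (exp (- log_trunc r z) * z ^ i / (z - 1)))"
    unfolding error_integral_def
    by (rule contour_integral_eq) (use x in \<open>auto simp: divide_simps algebra_simps\<close>)
  ultimately show ?thesis by simp
qed

lemma error_integral_1_0:
  "error_integral r x 1 0 = 2 * pi * \<i> * complex_of_real (1 - exp (- harm r))"
proof -
  have "((\<lambda>z. exp (- log_trunc r z) / (z - 0)) has_contour_integral
      (2 * of_real pi * \<i> * exp (- log_trunc r 0))) (circlepath 0 x)"
    by (rule Cauchy_integral_circlepath_simple) (use x in \<open>auto intro!: holomorphic_intros\<close>)
  moreover have "error_integral r x 0 0 = contour_integral (circlepath 0 x) (\<lambda>z. exp (- log_trunc r z) / (z - 0))"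
    unfolding error_integral_def
    by (rule contour_integral_eq) (use x in \<open>auto simp: power_int_minus divide_simps\<close>)
  ultimately have "error_integral r x 0 0 = 2 * pi * \<i>"
    using contour_integral_unique by fastforce
  then show ?thesis
    using error_integral_diff[of 0 0] error_integral_1_negative[of 0] by (simp add: algebra_simps)
qed

text \<open>
  Both sides obey the same recurrence, by one integration by parts. The terms with negative
  index, which are absent from the recurrence of $\kappa$, are the constants $-e^{-H_r}$ on
  the left, and these are what the subtraction of $e^{-H_r}$ on the right accounts for.
\<close>

lemma kappa_eq_error_integral:
  "error_integral r x 1 (int n) = 2 * pi * \<i> * complex_of_real (kappa n r - exp (- harm r))"
proof (induction n rule: less_induct)
  case (less n)
  show ?case
  proof (cases n)
    case 0
    then show ?thesis using error_integral_1_0 by simp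
  next
    case (Suc m)
    have a: "of_nat (Suc m) * error_integral r x 1 (int (Suc m)) = error_integral r x 2 (int m - int r)"
      using error_integral_by_parts[of "int (Suc m)" 1] by (simp add: numeral_2_eq_2)
    have b: "of_nat m * error_integral r x 1 (int m) = error_integral r x 2 (int m - int r - 1)"
      using error_integral_by_parts[of "int m" 1] by (simp add: numeral_2_eq_2 algebra_simps)
    have c: "error_integral r x 2 (int m - int r) - error_integral r x 2 (int m - int r - 1)
        = error_integral r x 1 (int m - int r)"
      using error_integral_diff[of 1 "int m - int r"] by (simp add: numeral_2_eq_2)
    have d: "error_integral r x 1 (int m - int r) =
        2 * pi * \<i> * complex_of_real ((if r \<le> m then kappa (m - r) r else 0) - exp (- harm r))"
    proof (cases "r \<le> m")
      case True
      then show ?thesis using less.IH[of "m - r"] Suc r by (simp add: of_nat_diff)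
    next
      case False
      then obtain i where "r = m + 1 + i" by (metis add.commute less_iff_Suc_add not_le plus_1_eq_Suc add_Suc_right)
      then have "int m - int r = - 1 - int i" by simp
      then show ?thesis using error_integral_1_negative[of i] False by simp
    qed
    have e: "error_integral r x 1 (int m) = 2 * pi * \<i> * complex_of_real (kappa m r - exp (- harm r))"
      using less.IH[of m] Suc by simp
    have "complex_of_nat (Suc m) * error_integral r x 1 (int (Suc m)) =
        of_nat m * error_integral r x 1 (int m) + error_integral r x 1 (int m - int r)"
      unfolding a b using c by (simp add: algebra_simps)
    also have "\<dots> = 2 * pi * \<i> * complex_of_real ((real m * kappa m r + (if r \<le> m then kappa (m - r) r else 0))
          - real (Suc m) * exp (- harm r))"
      unfolding d e by (simp add: algebra_simps)
    also have "\<dots> = of_nat (Suc m) * (2 * pi * \<i> * complex_of_real (kappa (Suc m) r - exp (- harm r)))"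
      unfolding kappa_step[symmetric] by (simp add: algebra_simps)
    finally show ?thesis unfolding Suc
      by (subst (asm) mult_cancel_left) (auto simp del: of_nat_Suc)
  qed
qed

text \<open>
  Two integrations by parts are made because they turn the integrand into one of size
  $|1-z|^{-2}$ (after the bound $|e^{-L(z)}| \le \beta |1-z|$). Its integral is at most of
  order $r$, which against the factor $n(n-r-1)$ leaves the decay needed in $r$; with fewer
  integrations the part of the circle away from $1$ would dominate.
\<close>

lemma kappa_error_eq_error_integral_3:
  assumes n: "n \<ge> r + 1"
  shows "complex_of_real (2 * pi * (real n * (real n - real r - 1) * (kappa n r - exp (- harm r)))) * \<i> =
    error_integral r x 3 (int n - 2 * int r - 2) + error_integral r x 3 (int n - int r - 2)"
proof -
  have a: "of_nat n * error_integral r x 1 (int n) = error_integral r x 2 (int n - int r - 1)"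
    using error_integral_by_parts[of "int n" 1] by (simp add: numeral_2_eq_2 algebra_simps)
  have b: "of_int (int n - int r - 1) * error_integral r x 2 (int n - int r - 1) =
    error_integral r x 3 (int n - 2 * int r - 2) + error_integral r x 3 (int n - int r - 2)"
    using error_integral_by_parts[of "int n - int r - 1" 2]
    by (simp add: numeral_2_eq_2 numeral_3_eq_3 algebra_simps)
  show ?thesis
    unfolding b[symmetric] a[symmetric] kappa_eq_error_integral by (simp add: algebra_simps)
qed

text \<open>
  On the circle $\overline{z} = x^2/z$, which makes $|1-z|^{-2}\,|dz|$ the restriction of a
  meromorphic form with the single pole $z = 1$ inside, and Cauchy's formula applies.
\<close>

lemma poisson_kernel_has_integral:
  "((\<lambda>s. 1 / (cmod (1 - circlepath 0 x s))\<^sup>2) has_integral 1 / (x\<^sup>2 - 1)) {0..1}"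
proof -
  let ?\<gamma> = "circlepath 0 x"
  have x2: "x\<^sup>2 > x" "x\<^sup>2 > 1" using x by (simp_all add: power2_eq_square) (metis less_1_mult)
  have hol: "(\<lambda>z. 1 / (of_real (x\<^sup>2) - z)) holomorphic_on cball 0 x"
  proof (intro holomorphic_intros)
    fix z assume "z \<in> cball (0::complex) x"
    then have "norm z < norm (complex_of_real (x\<^sup>2))" using x2 x by (simp add: norm_power)
    then show "of_real (x\<^sup>2) - z \<noteq> 0" by auto
  qed
  have "((\<lambda>z. 1 / (of_real (x\<^sup>2) - z) / (z - 1)) has_contour_integral
      (2 * of_real pi * \<i> * (1 / (of_real (x\<^sup>2) - 1)))) ?\<gamma>"
    by (rule Cauchy_integral_circlepath_simple[OF hol]) (use x in auto)
  then have "((\<lambda>s. 1 / (of_real (x\<^sup>2) - ?\<gamma> s) / (?\<gamma> s - 1) * vector_derivative ?\<gamma> (at s within {0..1}))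
      has_integral (2 * of_real pi * \<i> * (1 / (of_real (x\<^sup>2) - 1)))) {0..1}"
    by (simp add: has_contour_integral_def)
  then have "((\<lambda>s. (2 * of_real pi * \<i>) * of_real (1 / (cmod (1 - ?\<gamma> s))\<^sup>2))
      has_integral (2 * of_real pi * \<i> * (1 / (of_real (x\<^sup>2) - 1)))) {0..1}"
  proof (rule has_integral_eq[rotated])
    fix s :: real assume s: "s \<in> {0..1}"
    let ?z = "?\<gamma> s"
    have vd: "vector_derivative ?\<gamma> (at s within {0..1}) = 2 * of_real pi * \<i> * ?z"
      using s by (subst vector_derivative_circlepath01) (auto simp: circlepath)
    have nz: "cmod ?z = x" using x by (simp add: circlepath norm_mult norm_exp)
    then have zz: "of_real (x\<^sup>2) = ?z * cnj ?z" by (metis complex_norm_square)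
    have z: "?z \<noteq> 0" "?z \<noteq> 1" "cnj ?z \<noteq> 1" using nz x by (auto simp: complex_cnj_cancel_iff[of _ 1, simplified])
    have n2: "of_real ((cmod (1 - ?z))\<^sup>2) = (1 - ?z) * (1 - cnj ?z)"
      by (simp only: complex_norm_square) simp
    have "?z * cnj ?z - ?z = ?z * (cnj ?z - 1)" by (simp add: algebra_simps)
    then show "1 / (of_real (x\<^sup>2) - ?z) / (?z - 1) * vector_derivative ?\<gamma> (at s within {0..1})
       = (2 * of_real pi * \<i>) * of_real (1 / (cmod (1 - ?z))\<^sup>2)"
      unfolding vd of_real_divide n2 zz using z by (simp add: divide_simps) (simp add: algebra_simps)
  qed
  from has_integral_mult_right[OF this, of "1 / (2 * of_real pi * \<i>)"]
  have "((\<lambda>s. complex_of_real (1 / (cmod (1 - ?\<gamma> s))\<^sup>2)) has_integral of_real (1 / (x\<^sup>2 - 1))) {0..1}"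
    by simp
  from has_integral_Re[OF this] show ?thesis by simp
qed

lemma norm_error_integral_3_le:
  assumes \<beta>: "\<And>z. cmod z = x \<Longrightarrow> cmod (exp (- log_trunc r z)) \<le> \<beta> * cmod (1 - z)"
  shows "cmod (error_integral r x 3 N) \<le> 2 * pi * \<beta> * x powi (- N) / (x\<^sup>2 - 1)"
proof -
  let ?\<gamma> = "circlepath 0 x"
  let ?h = "\<lambda>z. exp (- log_trunc r z) * z powi (- N - 1) / (1 - z) ^ 3"
  let ?B = "2 * pi * \<beta> * x powi (- N)"
  have "((\<lambda>s. ?h (?\<gamma> s) * vector_derivative ?\<gamma> (at s within {0..1})) has_integral error_integral r x 3 N) {0..1}"
    using has_contour_integral_integral[OF error_integrand_integrable[of "- N - 1" 3]]
    by (simp add: has_contour_integral_def error_integral_def)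
  moreover have "((\<lambda>s. ?B * (1 / (cmod (1 - ?\<gamma> s))\<^sup>2)) has_integral ?B * (1 / (x\<^sup>2 - 1))) {0..1}"
    by (intro has_integral_mult_right poisson_kernel_has_integral)
  moreover have "cmod (?h (?\<gamma> s) * vector_derivative ?\<gamma> (at s within {0..1})) \<le> ?B * (1 / (cmod (1 - ?\<gamma> s))\<^sup>2)"
    if s: "s \<in> {0..1}" for s
  proof -
    let ?z = "?\<gamma> s"
    have nz: "cmod ?z = x" using x by (simp add: circlepath norm_mult norm_exp)
    then have z1: "cmod (1 - ?z) > 0" using x by auto
    have vd: "vector_derivative ?\<gamma> (at s within {0..1}) = 2 * of_real pi * \<i> * ?z"
      using s by (subst vector_derivative_circlepath01) (auto simp: circlepath)
    have xp: "x powi (- N) = x powi (- N - 1) * x"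
      using power_int_add_1[of x "- N - 1"] x by simp
    have "cmod (?h ?z * vector_derivative ?\<gamma> (at s within {0..1})) =
        cmod (exp (- log_trunc r ?z)) * (x powi (- N - 1) * (2 * pi * x)) / cmod (1 - ?z) ^ 3"
      unfolding vd by (simp add: norm_mult norm_divide norm_power norm_power_int nz)
    also have "\<dots> \<le> (\<beta> * cmod (1 - ?z)) * (x powi (- N - 1) * (2 * pi * x)) / cmod (1 - ?z) ^ 3"
      using z1 x by (intro divide_right_mono mult_right_mono \<beta> nz) auto
    also have "\<dots> = ?B * (1 / (cmod (1 - ?z))\<^sup>2)"
      using z1 by (simp add: xp power2_eq_square power3_eq_cube field_simps)
    finally show ?thesis .
  qed
  ultimately have "cmod (error_integral r x 3 N) \<le> ?B * (1 / (x\<^sup>2 - 1))"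
    using integral_norm_bound_integral[of "\<lambda>s. ?h (?\<gamma> s) * vector_derivative ?\<gamma> (at s within {0..1})" "{0..1}"
        "\<lambda>s. ?B * (1 / (cmod (1 - ?\<gamma> s))\<^sup>2)"]
    by (auto simp: has_integral_iff)
  then show ?thesis by simp
qed

lemma kappa_error_contour_bound:
  assumes \<beta>: "\<And>z. cmod z = x \<Longrightarrow> cmod (exp (- log_trunc r z)) \<le> \<beta> * cmod (1 - z)"
    and n: "n \<ge> r + 1"
  shows "real n * (real n - real r - 1) * \<bar>kappa n r - exp (- harm r)\<bar>
     \<le> 2 * \<beta> * x ^ (2 * r + 2) * x powi (- int n) / (x\<^sup>2 - 1)"
proof -
  have \<beta>0: "\<beta> \<ge> 0"
  proof -
    have "0 \<le> \<beta> * cmod (1 - of_real x)" using \<beta>[of "of_real x"] x by (smt (verit) norm_ge_zero norm_of_real)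
    moreover have "cmod (1 - of_real x) > 0" using x by auto
    ultimately show ?thesis by (simp add: zero_le_mult_iff)
  qed
  have x2: "x\<^sup>2 > 1" using x by simp
  have "2 * pi * (real n * (real n - real r - 1) * \<bar>kappa n r - exp (- harm r)\<bar>) =
     cmod (complex_of_real (2 * pi * (real n * (real n - real r - 1) * (kappa n r - exp (- harm r)))) * \<i>)"
    using n by (simp add: norm_mult abs_mult del: of_real_mult of_real_diff)
  also have "\<dots> \<le> cmod (error_integral r x 3 (int n - 2 * int r - 2)) + cmod (error_integral r x 3 (int n - int r - 2))"
    unfolding kappa_error_eq_error_integral_3[OF n] by (rule norm_triangle_ineq)
  also have "\<dots> \<le> 2 * pi * \<beta> * x powi (- (int n - 2 * int r - 2)) / (x\<^sup>2 - 1) +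
      2 * pi * \<beta> * x powi (- (int n - int r - 2)) / (x\<^sup>2 - 1)"
    by (intro add_mono norm_error_integral_3_le \<beta>)
  also have "\<dots> \<le> 2 * pi * \<beta> * x powi (- (int n - 2 * int r - 2)) / (x\<^sup>2 - 1) +
      2 * pi * \<beta> * x powi (- (int n - 2 * int r - 2)) / (x\<^sup>2 - 1)"
    using \<beta>0 x x2 by (intro add_left_mono divide_right_mono mult_left_mono power_int_increasing) auto
  also have "x powi (- (int n - 2 * int r - 2)) = x ^ (2 * r + 2) * x powi (- int n)"
  proof -
    have "- (int n - 2 * int r - 2) = int (2 * r + 2) + - int n" by simp
    then show ?thesis
      using power_int_add[of x "int (2 * r + 2)" "- int n"] x by (simp only: power_int_of_nat) simp
  qed
  finally have "2 * pi * (real n * (real n - real r - 1) * \<bar>kappa n r - exp (- harm r)\<bar>)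
      \<le> 2 * pi * (2 * \<beta> * x ^ (2 * r + 2) * x powi (- int n) / (x\<^sup>2 - 1))"
    by (simp add: field_simps)
  then show ?thesis by (subst (asm) mult_le_cancel_left_pos) auto
qed

end

text \<open>
  Already the circle of radius $2$ gives exponential convergence.
\<close>

lemma kappa_tendsto:
  assumes r: "r \<ge> 1"
  shows "(\<lambda>n. kappa n r) \<longlonglongrightarrow> exp (- harm r)"
proof -
  have "compact (sphere (0::complex) 2)" by simp
  moreover have "continuous_on (sphere 0 2) (\<lambda>z. exp (- log_trunc r z))"
    by (intro holomorphic_on_imp_continuous_on holomorphic_intros)
  ultimately have "bounded ((\<lambda>z. exp (- log_trunc r z)) ` sphere 0 2)"
    using compact_continuous_image compact_imp_bounded by blast
  then obtain B where "B > 0" and B': "\<forall>w\<in>(\<lambda>z. exp (- log_trunc r z)) ` sphere 0 2. cmod w \<le> B"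
    unfolding bounded_pos by blast
  from B' have B: "cmod (exp (- log_trunc r z)) \<le> B" if "cmod z = 2" for z
    using that by simp
  have bnd: "cmod (exp (- log_trunc r z)) \<le> B * cmod (1 - z)" if "cmod z = 2" for z
  proof -
    have "cmod (1 - z) \<ge> 1" using norm_triangle_ineq2[of z 1] that by (simp add: norm_minus_commute)
    then show ?thesis using B[OF that] \<open>B > 0\<close> by (smt (verit) mult_le_cancel_left1)
  qed
  let ?K = "2 * B * 2 ^ (2 * r + 2) / 3"
  have "\<bar>kappa n r - exp (- harm r)\<bar> \<le> ?K * (1 / 2) ^ n" if n: "n \<ge> r + 2" for n
  proof -
    have "1 * \<bar>kappa n r - exp (- harm r)\<bar> \<le> real n * (real n - real r - 1) * \<bar>kappa n r - exp (- harm r)\<bar>"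
    proof (intro mult_right_mono)
      have "1 * 1 \<le> real n * (real n - real r - 1)" using n by (intro mult_mono) auto
      then show "1 \<le> real n * (real n - real r - 1)" by simp
    qed simp
    also have "\<dots> \<le> 2 * B * 2 ^ (2 * r + 2) * 2 powi (- int n) / (2\<^sup>2 - 1)"
      by (rule kappa_error_contour_bound) (use r n bnd in auto)
    also have "\<dots> = ?K * (1 / 2) ^ n"
      by (simp add: power_int_minus power_divide field_simps)
    finally show ?thesis by simp
  qed
  then have "eventually (\<lambda>n. norm (kappa n r - exp (- harm r)) \<le> ?K * (1 / 2) ^ n) sequentially"
    by (auto simp: eventually_sequentially)
  moreover have "(\<lambda>n. ?K * (1 / 2) ^ n) \<longlonglongrightarrow> 0"
    by (intro tendsto_mult_right_zero LIMSEQ_power_zero) simp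
  ultimately have "(\<lambda>n. kappa n r - exp (- harm r)) \<longlonglongrightarrow> 0"
    by (rule Lim_null_comparison)
  then show ?thesis by (simp add: LIM_zero_iff)
qed

lemma kappa_error_le_nu:
  assumes "r \<ge> 1" "r < n"
  shows "\<bar>kappa n r - exp (- harm r)\<bar> \<le> 2 * real r * nu n r"
proof (rule tendsto_upperbound)
  show "(\<lambda>N. \<bar>kappa n r - kappa N r\<bar>) \<longlonglongrightarrow> \<bar>kappa n r - exp (- harm r)\<bar>"
    by (intro tendsto_intros kappa_tendsto assms)
  show "eventually (\<lambda>N. \<bar>kappa n r - kappa N r\<bar> \<le> 2 * real r * nu n r) sequentially"
    using eventually_ge_at_top[of n]
    by eventually_elim (use kappa_diff_le_nu[OF assms] in \<open>auto simp: abs_minus_commute\<close>)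
qed simp

section \<open>A lower bound for permutations without long cycles\<close>

lemma sums_delay:
  fixes f :: "nat \<Rightarrow> real"
  assumes "f sums s"
  shows "(\<lambda>m. if j \<le> m then f (m - j) else 0) sums s"
proof -
  have "(\<lambda>m. (\<lambda>m. if j \<le> m then f (m - j) else 0) (m + j)) sums s"
    using assms by simp
  then show ?thesis by (subst (asm) sums_iff_shift) simp
qed

text \<open>
  Weighting $m$ with $\nu(m) x^m / S$ gives a probability distribution on the natural numbers,
  the law of $\sum_{j \le r} j Z_j$ for independent Poisson variables $Z_j$ of mean $x^j/j$. It
  has mean $M$ and variance $V$.
\<close>

context
  fixes r :: nat and x M V S :: real
  assumes x: "x \<ge> 1" and r: "r \<ge> 1"
  defines "M \<equiv> \<Sum>j=1..r. x ^ j"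
    and "V \<equiv> \<Sum>j=1..r. real j * x ^ j"
    and "S \<equiv> exp (\<Sum>j=1..r. x ^ j / real j)"
begin

lemma nu_weighted_recurrence:
  "real m * (nu m r * x ^ m) = (\<Sum>j=1..r. x ^ j * (if j \<le> m then nu (m - j) r * x ^ (m - j) else 0))"
proof -
  have "(\<Sum>j=1..r. x ^ j * (if j \<le> m then nu (m - j) r * x ^ (m - j) else 0))
      = (\<Sum>j\<in>{j\<in>{1..r}. j \<le> m}. nu (m - j) r * x ^ m)"
    by (rule sum.mono_neutral_cong_right) (auto simp flip: power_add)
  also have "\<dots> = (\<Sum>i\<in>{m - r..<m}. nu i r * x ^ m)"
    by (rule sum.reindex_bij_witness[of _ "\<lambda>i. m - i" "\<lambda>i. m - i"]) auto
  also have "\<dots> = real m * (nu m r * x ^ m)"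
    by (simp add: nu_recurrence flip: sum_distrib_right)
  finally show ?thesis by simp
qed

lemma nu_zeroth_moment: "(\<lambda>m. nu m r * x ^ m) sums S"
  unfolding S_def by (rule nu_sums)

lemma nu_first_moment: "(\<lambda>m. real m * (nu m r * x ^ m)) sums (M * S)"
  unfolding nu_weighted_recurrence M_def sum_distrib_right
  by (intro sums_sum sums_mult sums_delay nu_zeroth_moment)

lemma nu_second_moment: "(\<lambda>m. (real m)\<^sup>2 * (nu m r * x ^ m)) sums (M\<^sup>2 * S + V * S)"
proof -
  have 1: "(real m)\<^sup>2 * (nu m r * x ^ m) =
     (\<Sum>j=1..r. x ^ j * ((if j \<le> m then real (m - j) * (nu (m - j) r * x ^ (m - j)) else 0)
         + real j * (if j \<le> m then nu (m - j) r * x ^ (m - j) else 0)))" for m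
  proof -
    have "(real m)\<^sup>2 * (nu m r * x ^ m) = real m * (real m * (nu m r * x ^ m))"
      by (simp add: power2_eq_square)
    also have "\<dots> = (\<Sum>j=1..r. real m * (x ^ j * (if j \<le> m then nu (m - j) r * x ^ (m - j) else 0)))"
      by (simp only: nu_weighted_recurrence sum_distrib_left)
    also have "\<dots> = (\<Sum>j=1..r. x ^ j * ((if j \<le> m then real (m - j) * (nu (m - j) r * x ^ (m - j)) else 0)
         + real j * (if j \<le> m then nu (m - j) r * x ^ (m - j) else 0)))"
      by (intro sum.cong refl) (auto simp: of_nat_diff algebra_simps)
    finally show ?thesis .
  qed
  have 2: "M\<^sup>2 * S + V * S = (\<Sum>j=1..r. x ^ j * (M * S + real j * S))"
  proof -
    have "(\<Sum>j=1..r. x ^ j * (M * S + real j * S)) = (\<Sum>j=1..r. x ^ j) * (M * S) + (\<Sum>j=1..r. real j * x ^ j) * S"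
      by (simp add: sum_distrib_left sum.distrib algebra_simps)
    then show ?thesis by (simp add: M_def V_def power2_eq_square)
  qed
  show ?thesis
    unfolding 1 2
    by (intro sums_sum sums_mult sums_add sums_delay nu_zeroth_moment nu_first_moment)
qed

lemma nu_variance: "(\<lambda>m. (real m - M)\<^sup>2 * (nu m r * x ^ m)) sums (V * S)"
proof -
  have "(\<lambda>m. (real m)\<^sup>2 * (nu m r * x ^ m) - 2 * M * (real m * (nu m r * x ^ m)) + M\<^sup>2 * (nu m r * x ^ m))
     sums ((M\<^sup>2 * S + V * S) - 2 * M * (M * S) + M\<^sup>2 * S)"
    by (intro sums_add sums_diff sums_mult nu_zeroth_moment nu_first_moment nu_second_moment)
  then show ?thesis by (simp add: power2_eq_square algebra_simps)
qed

lemma nu_chebyshev: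
  assumes w: "w > 0" "2 * V \<le> w\<^sup>2"
  shows "S / 2 \<le> (\<Sum>m\<in>{m. \<bar>real m - M\<bar> < w}. nu m r * x ^ m)"
proof -
  let ?A = "{m. \<bar>real m - M\<bar> < w}"
  have fin: "finite ?A"
  proof (rule finite_subset)
    show "?A \<subseteq> {..nat \<lceil>M + w\<rceil>}"
    proof
      fix m assume "m \<in> ?A"
      then have "real m \<le> M + w" by auto
      then show "m \<in> {..nat \<lceil>M + w\<rceil>}" by simp linarith
    qed
  qed simp
  have "S > 0" by (simp add: S_def)
  have "(\<lambda>m. nu m r * x ^ m - ((real m - M)\<^sup>2 * (nu m r * x ^ m)) / w\<^sup>2) sums (S - V * S / w\<^sup>2)"
    by (intro sums_diff sums_divide nu_zeroth_moment nu_variance)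
  moreover have "(\<lambda>m. if m \<in> ?A then nu m r * x ^ m else 0) sums (\<Sum>m\<in>?A. nu m r * x ^ m)"
    by (rule sums_If_finite_set[OF fin])
  moreover have "nu m r * x ^ m - ((real m - M)\<^sup>2 * (nu m r * x ^ m)) / w\<^sup>2
      \<le> (if m \<in> ?A then nu m r * x ^ m else 0)" for m
  proof -
    have p: "nu m r * x ^ m \<ge> 0" using nu_nonneg x by simp
    show ?thesis
    proof (cases "m \<in> ?A")
      case True
      then show ?thesis using p by simp
    next
      case False
      then have "w \<le> \<bar>real m - M\<bar>" by simp
      then have "w\<^sup>2 \<le> (real m - M)\<^sup>2" using w by (metis abs_le_square_iff abs_of_pos)
      then have "w\<^sup>2 * (nu m r * x ^ m) \<le> (real m - M)\<^sup>2 * (nu m r * x ^ m)"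
        by (rule mult_right_mono[OF _ p])
      then show ?thesis using False w by (simp add: field_simps)
    qed
  qed
  ultimately have "S - V * S / w\<^sup>2 \<le> (\<Sum>m\<in>?A. nu m r * x ^ m)"
    by (metis (no_types, lifting) sums_le)
  moreover have "V * S / w\<^sup>2 \<le> S / 2"
    using mult_right_mono[OF w(2), of S] \<open>S > 0\<close> w by (simp add: field_simps)
  ultimately show ?thesis by simp
qed

text \<open>
  The parameter $x$ is chosen such that the mean lies at distance $w$ to the right of $n$.
  Then all the mass found by Chebyshev's inequality sits at points $m$ with
  $n < m < n + 2w$, and there $\nu(m) \le \nu(n)$ by monotonicity, so that a lower bound for
  $\nu(n)$ at the single point $n$ results.
\<close>

lemma nu_saddle_point_bound:
  assumes w: "w > 0" "2 * V \<le> w\<^sup>2" and M: "M = real n + w"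
  shows "S \<le> 4 * w * (x powr (2 * w)) * (nu n r * x ^ n)"
proof -
  let ?A = "{m. \<bar>real m - M\<bar> < w}"
  have sub: "?A \<subseteq> {n<..n + nat \<lfloor>2 * w\<rfloor>}"
  proof
    fix m assume "m \<in> ?A"
    then have "real n < real m" "real m - real n < 2 * w" using M by auto
    then have "n < m" "int (m - n) \<le> \<lfloor>2 * w\<rfloor>" by (auto simp: of_nat_diff le_floor_iff)
    then show "m \<in> {n<..n + nat \<lfloor>2 * w\<rfloor>}" by auto
  qed
  then have "finite ?A" using finite_subset by blast
  have "card ?A \<le> nat \<lfloor>2 * w\<rfloor>" using card_mono[OF _ sub] by simp
  then have card: "real (card ?A) \<le> 2 * w" using w
    by (meson nat_le_real_less of_nat_floor of_nat_mono order_trans less_imp_le mult_pos_pos zero_less_numeral)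
  have "S / 2 \<le> (\<Sum>m\<in>?A. nu m r * x ^ m)" by (rule nu_chebyshev[OF w])
  also have "\<dots> \<le> (\<Sum>m\<in>?A. nu n r * (x ^ n * x powr (2 * w)))"
  proof (rule sum_mono)
    fix m assume m: "m \<in> ?A"
    then have "n \<le> m" using sub by auto
    have "x ^ m = x powr real m" using x by (simp add: powr_realpow)
    also have "\<dots> \<le> x powr (real n + 2 * w)" using x m M by (intro powr_mono) auto
    also have "\<dots> = x ^ n * x powr (2 * w)" using x by (simp add: powr_add powr_realpow)
    finally show "nu m r * x ^ m \<le> nu n r * (x ^ n * x powr (2 * w))"
      using nu_antimono[OF r \<open>n \<le> m\<close>] x by (intro mult_mono nu_nonneg) auto
  qed
  also have "\<dots> = real (card ?A) * (nu n r * (x ^ n * x powr (2 * w)))" by simp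
  also have "\<dots> \<le> 2 * w * (nu n r * (x ^ n * x powr (2 * w)))"
    using nu_nonneg x by (intro mult_right_mono card) auto
  finally show ?thesis by (simp add: mult_ac)
qed

end

section \<open>The generating function on a circle\<close>

lemma exp_minus_harm_le:
  assumes "r \<ge> 1"
  shows "exp (- harm r) \<le> 1 / real r"
proof -
  have "ln (real r) \<le> ln (real r + 1)" using assms by simp
  also have "\<dots> \<le> harm r" by (rule ln_le_harm)
  finally have "exp (ln (real r)) \<le> exp (harm r)" by simp
  then have "real r \<le> exp (harm r)" using assms by simp
  then show ?thesis using assms by (simp add: exp_minus field_simps)
qed

text \<open>
  With $\rho = 1 - 1/r$, the truncated logarithmic series at $\zeta$ differs by at most $2$
  from the full series $-\ln(1 - \rho\zeta)$: damping the first $r$ terms changes the sum by at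
  most $1$ because $1 - \rho^j \le j/r$, and the tail is at most $1/r$ times a geometric series
  with sum $r$.
\<close>

lemma exp_minus_unit_log_trunc_le:
  assumes \<zeta>: "cmod \<zeta> = 1" and r: "r \<ge> 1"
  shows "exp (- Re (\<Sum>j=1..r. \<zeta> ^ j / of_nat j)) \<le> exp 2 * cmod (1 - of_real (1 - 1 / real r) * \<zeta>)"
proof -
  define \<rho> where "\<rho> = 1 - 1 / real r"
  define w where "w = of_real \<rho> * \<zeta>"
  have \<rho>: "0 \<le> \<rho>" "\<rho> < 1" using r by (auto simp: \<rho>_def)
  have nw: "cmod w = \<rho>" using \<zeta> \<rho> by (simp add: w_def norm_mult)
  have w1: "1 - w \<noteq> 0" using nw \<rho> by auto
  have "(\<lambda>n. - ((- (- w)) ^ n) / of_nat n) sums ln (1 + (- w))"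
    by (rule Ln_series') (use nw \<rho> in simp)
  then have ser: "(\<lambda>n. w ^ n / of_nat n) sums (- Ln (1 - w))"
    using sums_minus by fastforce
  have split: "(\<lambda>n. w ^ (n + Suc r) / of_nat (n + Suc r)) sums (- Ln (1 - w) - (\<Sum>j<Suc r. w ^ j / of_nat j))"
    using sums_split_initial_segment[OF ser, of "Suc r"] .
  have tail: "cmod (- Ln (1 - w) - (\<Sum>j<Suc r. w ^ j / of_nat j)) \<le> 1"
  proof (rule norm_sums_le[OF split])
    have "(\<lambda>n. \<rho> ^ n) sums (1 / (1 - \<rho>))" using \<rho> by (intro geometric_sums) simp
    from sums_mult[OF this, of "1 / real r"] show "(\<lambda>n. 1 / real r * \<rho> ^ n) sums 1"
      using r by (simp add: \<rho>_def)
    fix n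
    have "cmod (w ^ (n + Suc r) / of_nat (n + Suc r)) = \<rho> ^ (n + Suc r) / real (n + Suc r)"
      by (simp only: norm_divide norm_power nw norm_of_nat)
    also have "\<dots> \<le> \<rho> ^ n / real r"
      using r \<rho> by (intro frac_le power_decreasing) auto
    finally show "cmod (w ^ (n + Suc r) / of_nat (n + Suc r)) \<le> 1 / real r * \<rho> ^ n" by simp
  qed
  have sum_eq: "(\<Sum>j<Suc r. w ^ j / of_nat j) = (\<Sum>j=1..r. w ^ j / of_nat j)"
    by (rule sum.mono_neutral_right) auto
  have head: "cmod ((\<Sum>j=1..r. \<zeta> ^ j / of_nat j) - (\<Sum>j=1..r. w ^ j / of_nat j)) \<le> 1"
  proof -
    have "cmod ((\<Sum>j=1..r. \<zeta> ^ j / of_nat j) - (\<Sum>j=1..r. w ^ j / of_nat j))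
       \<le> (\<Sum>j=1..r. cmod (\<zeta> ^ j / of_nat j - w ^ j / of_nat j))"
      unfolding sum_subtractf[symmetric] by (rule norm_sum)
    also have "\<dots> \<le> (\<Sum>j=1..r. 1 / real r)"
    proof (rule sum_mono)
      fix j assume j: "j \<in> {1..r}"
      have "\<zeta> ^ j / of_nat j - w ^ j / of_nat j = of_real (1 - \<rho> ^ j) * \<zeta> ^ j / of_nat j"
        by (simp add: w_def power_mult_distrib algebra_simps diff_divide_distrib)
      then have "cmod (\<zeta> ^ j / of_nat j - w ^ j / of_nat j) = cmod (of_real (1 - \<rho> ^ j)) / real j"
        by (simp add: norm_mult norm_divide norm_power \<zeta> del: of_real_diff)
      also have "\<dots> = (1 - \<rho> ^ j) / real j"
        using \<rho> power_le_one[of \<rho> j] by (simp add: norm_of_real del: of_real_diff)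
      also have "1 - \<rho> ^ j \<le> real j * (1 / real r)"
        using Bernoulli_inequality[of "- 1 / real r" j] r by (simp add: \<rho>_def field_simps)
      finally show "cmod (\<zeta> ^ j / of_nat j - w ^ j / of_nat j) \<le> 1 / real r"
        using j by (simp add: field_simps)
    qed
    also have "\<dots> = 1" using r by simp
    finally show ?thesis .
  qed
  have "cmod ((\<Sum>j=1..r. \<zeta> ^ j / of_nat j) - (- Ln (1 - w))) \<le> 2"
    using norm_triangle_ineq4[of "(\<Sum>j=1..r. \<zeta> ^ j / of_nat j) - (\<Sum>j=1..r. w ^ j / of_nat j)"
        "- Ln (1 - w) - (\<Sum>j=1..r. w ^ j / of_nat j)"] head tail
    unfolding sum_eq by simp
  then have "cmod (- Ln (1 - w) - (\<Sum>j=1..r. \<zeta> ^ j / of_nat j)) \<le> 2"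
    by (subst norm_minus_commute)
  from order_trans[OF complex_Re_le_cmod this]
  have "Re (- Ln (1 - w)) - Re (\<Sum>j=1..r. \<zeta> ^ j / of_nat j) \<le> 2"
    by simp
  then have "- Re (\<Sum>j=1..r. \<zeta> ^ j / of_nat j) \<le> 2 + ln (cmod (1 - w))"
    using w1 by (simp add: Re_Ln)
  then have "exp (- Re (\<Sum>j=1..r. \<zeta> ^ j / of_nat j)) \<le> exp (2 + ln (cmod (1 - w)))"
    by simp
  also have "\<dots> = exp 2 * cmod (1 - w)" using w1 by (simp add: exp_add)
  finally show ?thesis by (simp add: w_def \<rho>_def)
qed

lemma cmod_one_minus_scaled:
  assumes "cmod \<zeta> = 1"
  shows "(cmod (1 - of_real x * \<zeta>))\<^sup>2 = (x - 1)\<^sup>2 + x * (cmod (1 - \<zeta>))\<^sup>2"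
proof -
  have "(Re \<zeta>)\<^sup>2 + (Im \<zeta>)\<^sup>2 = 1" using assms cmod_power2[of \<zeta>] by simp
  then show ?thesis
    unfolding cmod_power2 by (simp add: power2_eq_square) algebra
qed

lemma sqrt_one_plus_bound:
  fixes y :: real
  assumes "0 \<le> y" "y \<le> 1"
  shows "1 \<le> (1 - y / 4)\<^sup>2 * (1 + y)"
proof -
  have "(1 - y / 4)\<^sup>2 * (1 + y) = 1 + y * (1 / 2 - y * (7 / 16) + y\<^sup>2 / 16)"
    by (simp add: power2_eq_square field_simps)
  moreover have "y * (1 / 2 - y * (7 / 16) + y\<^sup>2 / 16) \<ge> 0"
    using assms by (intro mult_nonneg_nonneg) (auto intro!: add_nonneg_nonneg)
  ultimately show ?thesis by simp
qed

text \<open>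
  This is where the exponential saving comes from: the powers $\zeta, \ldots, \zeta^r$ cannot
  all be close to $-1$. If $\zeta$ is within $1/r$ of $1$, all the real parts are nonnegative.
  Otherwise the sum of the $(x\zeta)^j$ is a geometric sum whose denominator
  $|1 - x\zeta|$ exceeds $x - 1$ by a factor of at least $\sqrt{1 + y}$, and it is smaller than $\sum x^j$
  accordingly.
\<close>

lemma weighted_cosine_gain:
  assumes x: "x > 1" and r: "r \<ge> 1" and \<zeta>: "cmod \<zeta> = 1"
    and y: "0 \<le> y" "y \<le> 1" "y * (real r * (x - 1))\<^sup>2 \<le> x"
  shows "(\<Sum>j=1..r. x ^ j * (1 + Re (\<zeta> ^ j))) \<ge> (\<Sum>j=1..r. x ^ j) * (y / 4) - 2 * x / (x - 1)"
proof -
  let ?M = "\<Sum>j=1..r. x ^ j"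
  have M0: "?M \<ge> 0" using x by (intro sum_nonneg) auto
  have e0: "2 * x / (x - 1) \<ge> 0" using x by simp
  show ?thesis
  proof (cases "cmod (1 - \<zeta>) \<le> 1 / real r")
    case True
    have "?M \<le> (\<Sum>j=1..r. x ^ j * (1 + Re (\<zeta> ^ j)))"
    proof (rule sum_mono)
      fix j assume j: "j \<in> {1..r}"
      have "cmod (1 ^ j - \<zeta> ^ j) \<le> real j * cmod (1 - \<zeta>)"
        by (rule norm_power_diff) (use \<zeta> in auto)
      also have "\<dots> \<le> real r * (1 / real r)" using j True by (intro mult_mono) auto
      finally have "cmod (1 - \<zeta> ^ j) \<le> 1" using r by simp
      then have "Re (\<zeta> ^ j) \<ge> 0" using complex_Re_le_cmod[of "1 - \<zeta> ^ j"] by simp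
      then show "x ^ j \<le> x ^ j * (1 + Re (\<zeta> ^ j))" using x by simp
    qed
    moreover have "?M * (y / 4) \<le> ?M * 1" using y M0 by (intro mult_left_mono) auto
    ultimately show ?thesis using e0 by linarith
  next
    case False
    let ?z = "of_real x * \<zeta>"
    let ?d = "cmod (1 - ?z)"
    \<comment> \<open>Away from 1 the denominator of the geometric sum is larger than x - 1.\<close>
    have d2: "?d\<^sup>2 \<ge> (x - 1)\<^sup>2 * (1 + y)"
    proof -
      have "(1 / real r)\<^sup>2 \<le> (cmod (1 - \<zeta>))\<^sup>2" using False by (intro power_mono) auto
      then have "x * (1 / real r)\<^sup>2 \<le> x * (cmod (1 - \<zeta>))\<^sup>2" using x by (intro mult_left_mono) auto
      moreover have "(x - 1)\<^sup>2 * y \<le> x * (1 / real r)\<^sup>2"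
        using y(3) r by (simp add: power_mult_distrib power_divide pos_le_divide_eq mult_ac)
      ultimately show ?thesis unfolding cmod_one_minus_scaled[OF \<zeta>] by (simp add: algebra_simps)
    qed
    have dpos: "?d > 0"
    proof -
      have "?d\<^sup>2 > 0" using d2 x y by (smt (verit) mult_pos_pos zero_less_power)
      then show ?thesis by (metis norm_ge_zero less_le power_zero_numeral)
    qed
    have "(x - 1)\<^sup>2 \<le> (?d * (1 - y / 4))\<^sup>2"
    proof -
      have "(x - 1)\<^sup>2 * 1 \<le> (x - 1)\<^sup>2 * ((1 - y / 4)\<^sup>2 * (1 + y))"
        by (intro mult_left_mono sqrt_one_plus_bound y) auto
      also have "\<dots> = ((x - 1)\<^sup>2 * (1 + y)) * (1 - y / 4)\<^sup>2" by (simp add: mult_ac)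
      also have "\<dots> \<le> ?d\<^sup>2 * (1 - y / 4)\<^sup>2" by (intro mult_right_mono d2) auto
      finally show ?thesis by (simp add: power_mult_distrib)
    qed
    then have d1: "x - 1 \<le> ?d * (1 - y / 4)"
      by (rule power2_le_imp_le) (use y in auto)
    have d0: "x - 1 \<le> ?d"
      using d1 mult_left_mono[of "1 - y / 4" 1 ?d] y by auto
    let ?P = "\<Sum>j=1..r. ?z ^ j"
    have geo: "?P * (1 - ?z) = ?z * (1 - ?z ^ r)"
    proof -
      have "?P = (\<Sum>j<r. ?z ^ Suc j)"
        by (rule sum.reindex_bij_witness[of _ Suc "\<lambda>j. j - 1"]) auto
      then have "?P = ?z * (\<Sum>j<r. ?z ^ j)" by (simp add: sum_distrib_left)
      then show ?thesis using one_diff_power_eq[of ?z r] by (simp add: mult_ac)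
    qed
    have geoM: "?M * (x - 1) = x * (x ^ r - 1)"
    proof -
      have "?M = (\<Sum>j<r. x ^ Suc j)"
        by (rule sum.reindex_bij_witness[of _ Suc "\<lambda>j. j - 1"]) auto
      then have "?M * (x - 1) = x * ((x - 1) * (\<Sum>j<r. x ^ j))" by (simp add: sum_distrib_left mult_ac)
      also have "(x - 1) * (\<Sum>j<r. x ^ j) = x ^ r - 1"
        using one_diff_power_eq[of x r] by (simp add: algebra_simps)
      finally show ?thesis .
    qed
    have "cmod ?P * ?d = x * cmod (1 - ?z ^ r)"
      using arg_cong[OF geo, of cmod] x \<zeta> by (simp add: norm_mult)
    also have "\<dots> \<le> x * (1 + x ^ r)"
      using norm_triangle_ineq4[of 1 "?z ^ r"] x \<zeta>
      by (intro mult_left_mono) (auto simp: norm_mult norm_power)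
    also have "\<dots> = ?M * (x - 1) + 2 * x" unfolding geoM by (simp add: algebra_simps)
    also have "\<dots> \<le> ?M * (?d * (1 - y / 4)) + (2 * x / (x - 1)) * ?d"
    proof (rule add_mono)
      show "?M * (x - 1) \<le> ?M * (?d * (1 - y / 4))" by (intro mult_left_mono d1 M0)
      have "2 * x = (2 * x / (x - 1)) * (x - 1)" using x by simp
      also have "\<dots> \<le> (2 * x / (x - 1)) * ?d" by (intro mult_left_mono d0 e0)
      finally show "2 * x \<le> (2 * x / (x - 1)) * ?d" .
    qed
    also have "\<dots> = (?M * (1 - y / 4) + 2 * x / (x - 1)) * ?d" by (simp add: algebra_simps)
    finally have P: "cmod ?P \<le> ?M * (1 - y / 4) + 2 * x / (x - 1)"
      using dpos by (simp add: mult_le_cancel_right)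
    have "(\<Sum>j=1..r. x ^ j * (1 + Re (\<zeta> ^ j))) = ?M + Re ?P"
      by (simp add: sum.distrib power_mult_distrib algebra_simps flip: of_real_power)
    moreover have "Re ?P \<ge> - cmod ?P" using abs_Re_le_cmod[of ?P] by linarith
    moreover have "?M * (1 - y / 4) = ?M - ?M * (y / 4)" by (simp add: right_diff_distrib)
    ultimately show ?thesis using P by linarith
  qed
qed

text \<open>
  In $L(x) + \mathrm{Re}\, L(z) = \sum_j (x^j/j) (1 + \mathrm{Re}\, \zeta^j)$ the weights are
  split as $x^j = 1 + (x^j - 1)$. The first part is a logarithm and produces the factor
  $|1 - z|/r$. The second part contains the exponential saving.
\<close>

lemma exp_minus_log_trunc_bound:
  assumes x: "x > 1" and r: "r \<ge> 1" and z: "cmod z = x"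
    and rx: "real r * (x - 1) \<ge> 1"
    and y: "0 \<le> y" "y \<le> 1" "y * (real r * (x - 1))\<^sup>2 \<le> x"
  shows "cmod (exp (- log_trunc r z)) \<le>
    (exp (\<Sum>j=1..r. x ^ j / real j) * (2 * exp 4 / real r) *
      exp (2 * x / (real r * (x - 1)) - (\<Sum>j=1..r. x ^ j) * y / (4 * real r))) * cmod (1 - z)"
proof -
  define \<zeta> where "\<zeta> = z / of_real x"
  have \<zeta>: "cmod \<zeta> = 1" using z x by (simp add: \<zeta>_def norm_divide)
  have z\<zeta>: "z = of_real x * \<zeta>" using x by (simp add: \<zeta>_def)
  let ?M = "\<Sum>j=1..r. x ^ j"
  let ?L = "\<Sum>j=1..r. x ^ j / real j"
  let ?E = "2 * x / (real r * (x - 1)) - ?M * y / (4 * real r)"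
  have Re1: "\<bar>Re (\<zeta> ^ j)\<bar> \<le> 1" for j
    using abs_Re_le_cmod[of "\<zeta> ^ j"] by (simp add: norm_power \<zeta>)
  have Re1': "1 + Re (\<zeta> ^ j) \<ge> 0" "1 + Re (\<zeta> ^ j) \<le> 2" for j
    using Re1[of j] by linarith+
  have gain: "(\<Sum>j=1..r. (x ^ j - 1) / real j * (1 + Re (\<zeta> ^ j))) \<ge> - ?E - 2"
  proof -
    have "real r * (- ?E - 2) = ?M * (y / 4) - 2 * x / (x - 1) - 2 * real r"
      using r x by (simp add: field_simps)
    also have "\<dots> \<le> (\<Sum>j=1..r. x ^ j * (1 + Re (\<zeta> ^ j))) - (\<Sum>j=1..r. 1 + Re (\<zeta> ^ j))"
    proof -
      have "(\<Sum>j=1..r. 1 + Re (\<zeta> ^ j)) \<le> (\<Sum>j=1..r. 2)" by (intro sum_mono Re1')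
      then show ?thesis using weighted_cosine_gain[OF x r \<zeta> y] by simp
    qed
    also have "\<dots> = (\<Sum>j=1..r. (x ^ j - 1) * (1 + Re (\<zeta> ^ j)))"
      by (simp add: algebra_simps flip: sum_subtractf)
    also have "\<dots> \<le> (\<Sum>j=1..r. real r * ((x ^ j - 1) / real j * (1 + Re (\<zeta> ^ j))))"
    proof (rule sum_mono)
      fix j assume j: "j \<in> {1..r}"
      have "1 * ((x ^ j - 1) * (1 + Re (\<zeta> ^ j))) \<le> (real r / real j) * ((x ^ j - 1) * (1 + Re (\<zeta> ^ j)))"
        using j x Re1' by (intro mult_right_mono mult_nonneg_nonneg) (auto simp: one_le_power)
      then show "(x ^ j - 1) * (1 + Re (\<zeta> ^ j)) \<le> real r * ((x ^ j - 1) / real j * (1 + Re (\<zeta> ^ j)))"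
        by simp
    qed
    also have "\<dots> = real r * (\<Sum>j=1..r. (x ^ j - 1) / real j * (1 + Re (\<zeta> ^ j)))"
      by (simp add: sum_distrib_left)
    finally show ?thesis using r by (simp add: mult_le_cancel_left_pos)
  qed
  have "Re (log_trunc r z) = (\<Sum>j=1..r. x ^ j / real j * Re (\<zeta> ^ j))"
    unfolding log_trunc_def z\<zeta> by (simp add: power_mult_distrib flip: of_real_power)
  then have "- Re (log_trunc r z) = ?L - harm r - (\<Sum>j=1..r. Re (\<zeta> ^ j) / real j)
      - (\<Sum>j=1..r. (x ^ j - 1) / real j * (1 + Re (\<zeta> ^ j)))"
    unfolding harm_def
    by (simp add: inverse_eq_divide algebra_simps add_divide_distrib diff_divide_distrib
          flip: sum_subtractf sum.distrib sum_negf)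
  also have "(\<Sum>j=1..r. Re (\<zeta> ^ j) / real j) = Re (\<Sum>j=1..r. \<zeta> ^ j / of_nat j)" by simp
  finally have "- Re (log_trunc r z) \<le> ?L + - harm r + - Re (\<Sum>j=1..r. \<zeta> ^ j / of_nat j) + (?E + 2)"
    using gain by linarith
  then have "exp (- Re (log_trunc r z)) \<le>
      exp (?L + - harm r + - Re (\<Sum>j=1..r. \<zeta> ^ j / of_nat j) + (?E + 2))" by simp
  also have "\<dots> = exp ?L * exp (- harm r) * exp (- Re (\<Sum>j=1..r. \<zeta> ^ j / of_nat j)) * (exp ?E * exp 2)"
    by (simp only: exp_add)
  also have "\<dots> \<le> exp ?L * (1 / real r) * (exp 2 * (2 * cmod (1 - z))) * (exp ?E * exp 2)"
  proof (intro mult_mono order_refl exp_minus_harm_le r)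
    have d2: "(cmod (1 - z))\<^sup>2 = (x - 1)\<^sup>2 + x * (cmod (1 - \<zeta>))\<^sup>2"
      unfolding z\<zeta> by (rule cmod_one_minus_scaled[OF \<zeta>])
    have "x - 1 \<le> cmod (1 - z)"
      by (rule power2_le_imp_le) (use d2 x in auto)
    moreover have "1 / real r \<le> x - 1" using rx r by (simp add: field_simps)
    moreover have "cmod (1 - \<zeta>) \<le> cmod (1 - z)"
    proof (rule power2_le_imp_le)
      have "1 * (cmod (1 - \<zeta>))\<^sup>2 \<le> x * (cmod (1 - \<zeta>))\<^sup>2" using x by (intro mult_right_mono) auto
      then show "(cmod (1 - \<zeta>))\<^sup>2 \<le> (cmod (1 - z))\<^sup>2" using d2 by (smt (verit) zero_le_power2)
    qed simp
    moreover have "cmod (1 - of_real (1 - 1 / real r) * \<zeta>) \<le> cmod (1 - \<zeta>) + 1 / real r"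
    proof -
      have eq: "1 - of_real (1 - 1 / real r) * \<zeta> = (1 - \<zeta>) + of_real (1 / real r) * \<zeta>"
        by (simp add: algebra_simps)
      show ?thesis
        unfolding eq using norm_triangle_ineq[of "1 - \<zeta>" "of_real (1 / real r) * \<zeta>"] \<zeta> r
        by (simp add: norm_mult norm_divide)
    qed
    ultimately have "cmod (1 - of_real (1 - 1 / real r) * \<zeta>) \<le> 2 * cmod (1 - z)" by linarith
    then show "exp (- Re (\<Sum>j=1..r. \<zeta> ^ j / of_nat j)) \<le> exp 2 * (2 * cmod (1 - z))"
      using exp_minus_unit_log_trunc_le[OF \<zeta> r] by (smt (verit) exp_gt_zero mult_left_mono)
  qed (use r in auto)
  also have "\<dots> = (exp ?L * (2 * (exp 2 * exp 2) / real r) * exp ?E) * cmod (1 - z)"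
    by (simp add: field_simps)
  also have "exp 2 * exp 2 = exp (4::real)" by (simp flip: exp_add)
  finally show ?thesis by (simp add: norm_exp_eq_Re)
qed

section \<open>Choice of the saddle point\<close>

lemma saddle_point_exists:
  assumes r: "r \<ge> 1" and T: "T > real r"
  shows "\<exists>x>1. (\<Sum>j=1..r. x ^ j) = (T::real)"
proof -
  let ?f = "\<lambda>x::real. \<Sum>j=1..r. x ^ j"
  have T1: "T \<ge> 1" using r T by linarith
  have "\<exists>x\<ge>1. x \<le> T \<and> ?f x = T"
  proof (rule IVT')
    show "?f 1 \<le> T" using T by simp
    have "T ^ 1 \<le> ?f T"
      by (rule member_le_sum) (use r T1 in auto)
    then show "T \<le> ?f T" by simp
    show "continuous_on {1..T} ?f" by (intro continuous_intros)
  qed (fact T1)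
  then obtain x where x: "x \<ge> 1" "?f x = T" by blast
  have "x \<noteq> 1" using x T by auto
  then show ?thesis using x by (intro exI[of _ x]) auto
qed

text \<open>
  The mean of the weighted distribution is placed at $n + w$ with $w = 2r\sqrt u$, at
  least $\sqrt 2$ standard deviations beyond $n$. In terms of $l = r \ln x$, shifting the
  mean costs $x^{2w} = e^{4 \sqrt u\, l}$ and the two integrations by parts cost
  $x^{2r+2} \le e^{3l}$, while the saving is $\exp(-u/(4 x l^2))$.
\<close>

lemma kappa_error_saddle_bound:
  assumes r: "r \<ge> 2" and n: "n \<ge> 4 * r"
  defines "u \<equiv> real n / real r"
  shows "\<exists>l. 1 \<le> l \<and> l \<le> 2 * ln (2 * u) \<and>
    \<bar>kappa n r - exp (- harm r)\<bar> \<le> 32 * exp 4 * (nu n r / real r *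
      exp ((3 + 4 * sqrt u) * l + 2 * exp (l / real r) - u / (4 * exp (l / real r) * l\<^sup>2)))"
proof -
  have n0: "real n > 0" "real r > 0" using r n by auto
  have nu: "real n = u * real r" using n0 by (simp add: u_def)
  have rn: "4 * real r \<le> real n" using of_nat_mono[OF n, where 'a=real] by simp
  have u4: "u \<ge> 4" using rn n0 by (simp add: u_def field_simps)
  define w where "w = 2 * real r * sqrt u"
  have w0: "w > 0" using u4 n0 by (simp add: w_def)
  have w2: "w\<^sup>2 = 4 * real r * real n"
    using u4 by (simp add: w_def power_mult_distrib nu power2_eq_square)
  have wn: "w \<le> real n"
  proof (rule power2_le_imp_le)
    have "4 * real r * real n \<le> real n * real n" using rn by (rule mult_right_mono) simp
    then show "w\<^sup>2 \<le> (real n)\<^sup>2" unfolding w2 by (simp add: power2_eq_square)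
  qed (use n0 in simp)
  have "real n + w > real r" using rn w0 n0 by linarith
  then obtain x where x: "x > 1" and Mx: "(\<Sum>j=1..r. x ^ j) = real n + w"
    using saddle_point_exists[of r "real n + w"] r by auto
  let ?M = "\<Sum>j=1..r. x ^ j"
  define l where "l = real r * ln x"
  have lnx: "ln x > 0" using x by simp
  have expl: "exp (l / real r) = x" using x n0 by (simp add: l_def)
  have xr: "x ^ j = exp (real j * ln x)" for j using x by (simp add: exp_of_nat_mult)
  have "?M \<le> (\<Sum>j=1..r. x ^ r)"
    by (rule sum_mono) (use x in \<open>auto intro: power_increasing\<close>)
  then have "real n \<le> real r * exp l" using Mx w0 by (simp add: l_def xr)
  then have "u \<le> exp l" using n0 by (simp add: u_def field_simps)
  then have "exp 1 \<le> exp l" using u4 exp_le by linarith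
  then have l1: "l \<ge> 1" by simp
  have lu: "l \<le> 2 * ln (2 * u)"
  proof -
    \<comment> \<open>Pairing the powers of exponents j and r + 1 - j and using the geometric mean of each pair.\<close>
    have "real r * (2 * exp (l / 2)) = (\<Sum>j=1..r. 2 * exp (l / 2))" by simp
    also have "\<dots> \<le> (\<Sum>j=1..r. x ^ j + x ^ (r + 1 - j))"
    proof (rule sum_mono)
      fix j assume j: "j \<in> {1..r}"
      have "2 * exp (l / 2) \<le> 2 * (exp (real j * ln x / 2) * exp (real (r + 1 - j) * ln x / 2))"
      proof -
        have "real (r + 1 - j) = real r + 1 - real j" using j by auto
        then have "real j * ln x / 2 + real (r + 1 - j) * ln x / 2 = l / 2 + ln x / 2"
          by (simp add: l_def field_simps)
        then have "l / 2 \<le> real j * ln x / 2 + real (r + 1 - j) * ln x / 2" using lnx by linarith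
        then have "exp (l / 2) \<le> exp (real j * ln x / 2 + real (r + 1 - j) * ln x / 2)"
          by (simp only: exp_le_cancel_iff)
        then show ?thesis by (simp only: exp_add)
      qed
      also have "\<dots> \<le> (exp (real j * ln x / 2))\<^sup>2 + (exp (real (r + 1 - j) * ln x / 2))\<^sup>2"
        using sum_squares_bound[of "exp (real j * ln x / 2)" "exp (real (r + 1 - j) * ln x / 2)"]
        by (simp only: mult.assoc)
      also have "\<dots> = x ^ j + x ^ (r + 1 - j)"
        unfolding xr by (simp flip: exp_double)
      finally show "2 * exp (l / 2) \<le> x ^ j + x ^ (r + 1 - j)" .
    qed
    also have "\<dots> = ?M + (\<Sum>j=1..r. x ^ (r + 1 - j))" by (rule sum.distrib)
    also have "(\<Sum>j=1..r. x ^ (r + 1 - j)) = ?M"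
      by (rule sum.reindex_bij_witness[of _ "\<lambda>j. r + 1 - j" "\<lambda>j. r + 1 - j"]) auto
    also have "?M + ?M \<le> 4 * real n" using wn Mx by simp
    finally have "exp (l / 2) \<le> 2 * u" using n0 by (simp add: u_def field_simps)
    then have "l / 2 \<le> ln (2 * u)" using u4 by (subst ln_ge_iff) auto
    then show ?thesis by simp
  qed
  have V: "2 * (\<Sum>j=1..r. real j * x ^ j) \<le> w\<^sup>2"
  proof -
    have "(\<Sum>j=1..r. real j * x ^ j) \<le> (\<Sum>j=1..r. real r * x ^ j)"
      by (rule sum_mono) (use x in \<open>auto intro: mult_right_mono\<close>)
    also have "\<dots> = real r * (real n + w)" by (simp only: Mx sum_distrib_left[symmetric])
    also have "\<dots> \<le> real r * (2 * real n)" using wn n0 by (intro mult_left_mono) auto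
    finally show ?thesis unfolding w2 by (simp add: mult_ac)
  qed
  have S: "exp (\<Sum>j=1..r. x ^ j / real j) \<le> 4 * w * (x powr (2 * w)) * (nu n r * x ^ n)"
    by (rule nu_saddle_point_bound[OF _ _ w0 V Mx]) (use x r in auto)
  have "ln x \<le> x - 1" using x by (intro ln_le_minus_one) auto
  then have rx: "l \<le> real r * (x - 1)" using n0 by (simp add: l_def)
  have rx': "real r * (x - 1) \<le> x * l"
  proof -
    have "ln (1 / x) \<le> 1 / x - 1" using x by (intro ln_le_minus_one) auto
    then have "x - 1 \<le> x * ln x" using x by (simp add: ln_div field_simps)
    then have "real r * (x - 1) \<le> real r * (x * ln x)" using n0 by (intro mult_left_mono) auto
    then show ?thesis by (simp add: l_def mult_ac)
  qed
  define y where "y = 1 / (x * l\<^sup>2)"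
  have xl: "x * l\<^sup>2 \<ge> 1" using mult_mono[of 1 x 1 "l\<^sup>2"] x l1 by (simp add: one_le_power)
  have y: "0 \<le> y" "y \<le> 1" using xl by (auto simp: y_def field_simps)
  have y3: "y * (real r * (x - 1))\<^sup>2 \<le> x"
  proof -
    have "y * (real r * (x - 1))\<^sup>2 \<le> y * (x * l)\<^sup>2"
      using rx' x n0 y by (intro mult_left_mono power_mono) auto
    also have "\<dots> = x" using x l1 by (simp add: y_def power2_eq_square)
    finally show ?thesis .
  qed
  let ?L = "\<Sum>j=1..r. x ^ j / real j"
  let ?E = "2 * x / (real r * (x - 1)) - ?M * y / (4 * real r)"
  let ?\<beta> = "exp ?L * (2 * exp 4 / real r) * exp ?E"
  have "real n * (real n - real r - 1) * \<bar>kappa n r - exp (- harm r)\<bar>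
     \<le> 2 * ?\<beta> * x ^ (2 * r + 2) * x powi (- int n) / (x\<^sup>2 - 1)"
  proof (rule kappa_error_contour_bound)
    fix z assume z: "cmod z = x"
    show "cmod (exp (- log_trunc r z)) \<le> ?\<beta> * cmod (1 - z)"
      by (rule exp_minus_log_trunc_bound[OF x _ z _ y y3]) (use r rx l1 in auto)
  qed (use x r n in auto)
  also have "\<dots> = (2 * ?\<beta> * x ^ (2 * r + 2) * x powi (- int n)) * (1 / (x\<^sup>2 - 1))" by simp
  also have "\<dots> \<le> (2 * ?\<beta> * x ^ (2 * r + 2) * x powi (- int n)) * (real r / 2)"
  proof (intro mult_left_mono)
    have "2 * (x - 1) \<le> (x + 1) * (x - 1)" using x by (intro mult_right_mono) auto
    then have "2 * (x - 1) \<le> x\<^sup>2 - 1" by (simp add: power2_eq_square algebra_simps)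
    then have "real r * (2 * (x - 1)) \<le> real r * (x\<^sup>2 - 1)" using n0 by (intro mult_left_mono) auto
    then have "2 \<le> real r * (x\<^sup>2 - 1)" using rx l1 by linarith
    moreover have "x\<^sup>2 - 1 > 0" using x by simp
    ultimately show "1 / (x\<^sup>2 - 1) \<le> real r / 2" by (simp add: field_simps)
  qed (use x n0 in auto)
  also have "\<dots> = exp ?L * (x powi (- int n) * (2 * exp 4 * exp ?E * x ^ (2 * r + 2)))"
    using n0 by (simp add: field_simps)
  also have "\<dots> \<le> (4 * w * (x powr (2 * w)) * (nu n r * x ^ n)) * (x powi (- int n) * (2 * exp 4 * exp ?E * x ^ (2 * r + 2)))"
    by (intro mult_right_mono S) (use x in auto)
  also have "\<dots> = 8 * exp 4 * w * nu n r * (exp ?E * (x powr (2 * w) * x ^ (2 * r + 2)))"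
    using x by (simp add: power_int_minus field_simps)
  also have "\<dots> \<le> 8 * exp 4 * w * nu n r * exp ((3 + 4 * sqrt u) * l + 2 * x - u / (4 * x * l\<^sup>2))"
  proof (intro mult_left_mono)
    have "x powr (2 * w) = exp (4 * sqrt u * l)" using x by (simp add: powr_def w_def l_def mult_ac)
    moreover have "x ^ (2 * r + 2) \<le> exp (3 * l)"
    proof -
      have "real (2 * r + 2) * ln x \<le> real (3 * r) * ln x"
        using r lnx by (intro mult_right_mono) auto
      then show ?thesis unfolding xr by (simp add: l_def mult_ac)
    qed
    ultimately have "x powr (2 * w) * x ^ (2 * r + 2) \<le> exp (4 * sqrt u * l) * exp (3 * l)"
      by simp
    then have "exp ?E * (x powr (2 * w) * x ^ (2 * r + 2)) \<le> exp ?E * (exp (4 * sqrt u * l) * exp (3 * l))"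
      by (rule mult_left_mono) simp
    also have "\<dots> = exp (?E + (4 * sqrt u * l + 3 * l))" by (simp add: exp_add)
    also have "\<dots> \<le> exp ((3 + 4 * sqrt u) * l + 2 * x - u / (4 * x * l\<^sup>2))"
    proof -
      have "2 * x / (real r * (x - 1)) \<le> 2 * x / 1"
        using rx l1 x by (intro divide_left_mono) auto
      moreover have "u / (4 * x * l\<^sup>2) \<le> ?M * y / (4 * real r)"
      proof -
        have "u * y / 4 = real n * y / (4 * real r)" by (simp add: u_def)
        also have "\<dots> \<le> ?M * y / (4 * real r)"
          using Mx w0 y n0 by (intro divide_right_mono mult_right_mono) auto
        finally show ?thesis by (simp add: y_def mult_ac)
      qed
      ultimately show ?thesis by (simp add: algebra_simps)
    qed
    finally show "exp ?E * (x powr (2 * w) * x ^ (2 * r + 2)) \<le> exp ((3 + 4 * sqrt u) * l + 2 * x - u / (4 * x * l\<^sup>2))" .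
  qed (use w0 nu_nonneg in auto)
  finally have main: "real n * (real n - real r - 1) * \<bar>kappa n r - exp (- harm r)\<bar> \<le>
     8 * exp 4 * w * nu n r * exp ((3 + 4 * sqrt u) * l + 2 * x - u / (4 * x * l\<^sup>2))" (is "_ \<le> ?R") .
  \<comment> \<open>The factor sqrt u on the left cancels the one in w.\<close>
  have half: "(real r)\<^sup>2 * u * sqrt u / 2 \<le> real n * (real n - real r - 1)"
  proof -
    have "sqrt u \<le> u" using u4 by (intro real_le_lsqrt) (auto simp: power2_eq_square)
    then have "(real r)\<^sup>2 * u * sqrt u \<le> (real r)\<^sup>2 * u * u" using u4 by (intro mult_left_mono) auto
    also have "\<dots> = real n * real n" by (simp add: nu power2_eq_square)
    finally have "(real r)\<^sup>2 * u * sqrt u / 2 \<le> real n * (real n / 2)" by simp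
    also have "\<dots> \<le> real n * (real n - real r - 1)" using rn n0 by (intro mult_left_mono) auto
    finally show ?thesis .
  qed
  have "((real r)\<^sup>2 * u * sqrt u / 2) * \<bar>kappa n r - exp (- harm r)\<bar> \<le> ?R"
    using mult_right_mono[OF half, of "\<bar>kappa n r - exp (- harm r)\<bar>"] main by simp
  also have "?R = ((real r)\<^sup>2 * u * sqrt u / 2) * ((32 / u) * exp 4 * (nu n r / real r * exp ((3 + 4 * sqrt u) * l + 2 * x - u / (4 * x * l\<^sup>2))))"
    using n0 u4 by (simp add: w_def power2_eq_square field_simps)
  finally have "\<bar>kappa n r - exp (- harm r)\<bar> \<le> (32 / u) * exp 4 * (nu n r / real r * exp ((3 + 4 * sqrt u) * l + 2 * x - u / (4 * x * l\<^sup>2)))"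
    by (subst (asm) mult_le_cancel_left_pos) (use n0 u4 in auto)
  also have "\<dots> \<le> 32 * exp 4 * (nu n r / real r * exp ((3 + 4 * sqrt u) * l + 2 * x - u / (4 * x * l\<^sup>2)))"
    using u4 nu_nonneg[of n r] by (intro mult_right_mono) (auto simp: field_simps)
  finally show ?thesis using l1 lu expl by (intro exI[of _ l]) auto
qed

text \<open>
  Since $e^{l/r} \le (4/3) u^{2/r}$ and $l \le (5/2) \ln(u+1)$, the saving is at least
  $\frac{3}{100} u^{1-2/r} / \ln^2(u+1)$, and $\frac{3}{100} > \frac{1}{36} > \frac{1}{4\pi^2}$.
  The difference of the first two constants, times $u^{3/5} / \ln^2(u+1)$, eventually
  outgrows the losses, which are of order $\sqrt u \ln u$; this is where $r \ge 5$ is used.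
\<close>

lemma saddle_exponent_bound:
  "\<exists>U\<ge>4. \<forall>u\<ge>U. \<forall>r l. real r \<ge> 5 \<longrightarrow> 1 \<le> l \<longrightarrow> l \<le> 2 * ln (2 * u) \<longrightarrow>
     (3 + 4 * sqrt u) * l + 2 * exp (l / real r) - u / (4 * exp (l / real r) * l\<^sup>2)
       \<le> - (u powr (1 - 4 / real r) / (4 * pi\<^sup>2 * (ln (u + 1))\<^sup>2))"
proof -
  have "eventually (\<lambda>u::real. (3 + 4 * sqrt u) * (5 / 2 * ln (u + 1)) + 8 / 3 * u powr (2 / 5)
      \<le> (3 / 100 - 1 / 36) * (u powr (3 / 5) / (ln (u + 1))\<^sup>2)) at_top"
    by real_asymp
  moreover have "eventually (\<lambda>u::real. 2 * ln (2 * u) \<le> 5 / 2 * ln (u + 1)) at_top"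
    by real_asymp
  ultimately have "eventually (\<lambda>u::real. u \<ge> 4 \<and> 2 * ln (2 * u) \<le> 5 / 2 * ln (u + 1) \<and>
     (3 + 4 * sqrt u) * (5 / 2 * ln (u + 1)) + 8 / 3 * u powr (2 / 5)
      \<le> (3 / 100 - 1 / 36) * (u powr (3 / 5) / (ln (u + 1))\<^sup>2)) at_top"
    using eventually_ge_at_top[of 4] by eventually_elim auto
  then obtain U where U: "\<And>u. u \<ge> U \<Longrightarrow> u \<ge> 4 \<and> 2 * ln (2 * u) \<le> 5 / 2 * ln (u + 1) \<and>
     (3 + 4 * sqrt u) * (5 / 2 * ln (u + 1)) + 8 / 3 * u powr (2 / 5)
      \<le> (3 / 100 - 1 / 36) * (u powr (3 / 5) / (ln (u + 1))\<^sup>2)"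
    unfolding eventually_at_top_linorder by blast
  show ?thesis
  proof (intro exI[of _ "max U 4"] conjI allI impI)
    fix u l :: real and r :: nat
    assume u: "max U 4 \<le> u" and r: "5 \<le> real r" and l: "1 \<le> l" "l \<le> 2 * ln (2 * u)"
    define x where "x = exp (l / real r)"
    define c where "c = ln (u + 1)"
    have u4: "u \<ge> 4" and l_le: "l \<le> 5 / 2 * c"
      and asy: "(3 + 4 * sqrt u) * (5 / 2 * c) + 8 / 3 * u powr (2 / 5)
        \<le> (3 / 100 - 1 / 36) * (u powr (3 / 5) / c\<^sup>2)"
      using U[of u] u l by (auto simp: c_def)
    have c: "c > 0" using u4 by (simp add: c_def)
    have x_le: "x \<le> 4 / 3 * u powr (2 / real r)"
    proof -
      have "x \<le> exp (2 * ln (2 * u) / real r)" using l r by (simp add: x_def divide_right_mono)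
      also have "\<dots> = (2 * u) powr (2 / real r)" using u4 by (simp add: powr_def)
      also have "\<dots> = 2 powr (2 / real r) * u powr (2 / real r)" using u4 by (simp add: powr_mult)
      also have "2 powr (2 / real r) \<le> (4 / 3 :: real)"
      proof -
        have "2 powr (2 / real r) \<le> (2::real) powr (2 / 5)"
          using r by (intro powr_mono divide_left_mono) auto
        also have "\<dots> \<le> 4 / 3"
        proof (rule power_le_imp_le_base[of _ 4])
          have "((2::real) powr (2 / 5)) ^ Suc 4 = 2 powr (2 / 5 * 5)"
            by (simp add: powr_powr flip: powr_realpow)
          also have "\<dots> = 4" by simp
          also have "\<dots> \<le> (4 / 3) ^ Suc 4" by (simp add: power_divide)
          finally show "((2::real) powr (2 / 5)) ^ Suc 4 \<le> (4 / 3) ^ Suc 4" .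
        qed simp
        finally show ?thesis .
      qed
      finally show ?thesis by (simp add: mult_right_mono)
    qed
    have x_le': "x \<le> 4 / 3 * u powr (2 / 5)"
    proof -
      have "u powr (2 / real r) \<le> u powr (2 / 5)"
        using r u4 by (intro powr_mono divide_left_mono) auto
      then show ?thesis using x_le by simp
    qed
    have x0: "x > 0" by (simp add: x_def)
    have gain: "3 / 100 * (u powr (1 - 2 / real r) / c\<^sup>2) \<le> u / (4 * x * l\<^sup>2)"
    proof -
      have "4 * x * l\<^sup>2 \<le> 4 * (4 / 3 * u powr (2 / real r)) * (5 / 2 * c)\<^sup>2"
        using x_le l_le l x0 by (intro mult_mono power_mono) auto
      then have "u / (4 * (4 / 3 * u powr (2 / real r)) * (5 / 2 * c)\<^sup>2) \<le> u / (4 * x * l\<^sup>2)"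
        using x0 l u4 c by (intro divide_left_mono mult_pos_pos) auto
      moreover have "u / (4 * (4 / 3 * u powr (2 / real r)) * (5 / 2 * c)\<^sup>2)
         = 3 / 100 * (u powr (1 - 2 / real r) / c\<^sup>2)"
        using u4 c by (simp add: powr_diff power_mult_distrib power2_eq_square field_simps)
      ultimately show ?thesis by simp
    qed
    have small: "u powr (1 - 4 / real r) / (4 * pi\<^sup>2 * c\<^sup>2) \<le> 1 / 36 * (u powr (1 - 2 / real r) / c\<^sup>2)"
    proof -
      have "3\<^sup>2 \<le> pi\<^sup>2" using pi_gt3 by (intro power_mono) auto
      then have p: "36 * c\<^sup>2 \<le> 4 * pi\<^sup>2 * c\<^sup>2" by (intro mult_right_mono) auto
      have "u powr (1 - 4 / real r) / (4 * pi\<^sup>2 * c\<^sup>2) \<le> u powr (1 - 2 / real r) / (36 * c\<^sup>2)"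
        using u4 r c p by (intro frac_le powr_mono) (auto simp: field_simps)
      then show ?thesis by simp
    qed
    have big: "u powr (3 / 5) / c\<^sup>2 \<le> u powr (1 - 2 / real r) / c\<^sup>2"
      using u4 r by (intro divide_right_mono powr_mono) (auto simp: field_simps)
    have "(3 + 4 * sqrt u) * l + 2 * x \<le> (3 + 4 * sqrt u) * (5 / 2 * c) + 8 / 3 * u powr (2 / 5)"
    proof (rule add_mono)
      show "(3 + 4 * sqrt u) * l \<le> (3 + 4 * sqrt u) * (5 / 2 * c)"
        using l_le u4 by (intro mult_left_mono) auto
      show "2 * x \<le> 8 / 3 * u powr (2 / 5)" using x_le' by simp
    qed
    also note asy
    also have "(3 / 100 - 1 / 36) * (u powr (3 / 5) / c\<^sup>2) \<le> (3 / 100 - 1 / 36) * (u powr (1 - 2 / real r) / c\<^sup>2)"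
      by (intro mult_left_mono big) auto
    finally have "(3 + 4 * sqrt u) * l + 2 * x - u / (4 * x * l\<^sup>2)
        \<le> - (u powr (1 - 4 / real r) / (4 * pi\<^sup>2 * c\<^sup>2))"
      using gain small by (simp add: algebra_simps)
    then show "(3 + 4 * sqrt u) * l + 2 * exp (l / real r) - u / (4 * exp (l / real r) * l\<^sup>2)
       \<le> - (u powr (1 - 4 / real r) / (4 * pi\<^sup>2 * (ln (u + 1))\<^sup>2))"
      by (simp add: x_def c_def)
  qed simp
qed

text \<open>
  For bounded $u$ both $\kappa(n,r)$ and $e^{-H_r}$ are at most $1/r$, while $\nu(n,r)$ is
  bounded below.
\<close>

lemma kappa_error_bounded_ratio:
  assumes U: "U \<ge> 1"
  shows "\<exists>C\<ge>0. \<forall>n r. 1 \<le> r \<longrightarrow> r < n \<longrightarrow> real n \<le> U * real r \<longrightarrow>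
    \<bar>kappa n r - exp (- harm r)\<bar> \<le> C * (nu n r / real r)"
proof -
  obtain c where c: "c > 0" "\<And>n r. r \<ge> 1 \<Longrightarrow> real n \<le> U * real r \<Longrightarrow> c \<le> nu n r"
    using nu_lower_bound_bounded_ratio[OF U] by blast
  show ?thesis
  proof (intro exI[of _ "1 / c"] conjI allI impI)
    fix n r :: nat assume r: "1 \<le> r" "r < n" "real n \<le> U * real r"
    have "\<bar>kappa n r - exp (- harm r)\<bar> \<le> 1 / real r"
    proof (rule abs_leI)
      have e: "0 \<le> exp (- harm r :: real)" "exp (- harm r :: real) \<le> 1 / real r"
        using exp_minus_harm_le[of r] r by auto
      have k: "0 \<le> kappa n r" "kappa n r \<le> 1 / real r"
        using kappa_upper_bound[of r n] kappa_nonneg[of n r] r by auto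
      show "kappa n r - exp (- harm r) \<le> 1 / real r" using e k by linarith
      show "- (kappa n r - exp (- harm r)) \<le> 1 / real r" using e k by linarith
    qed
    also have "1 / real r \<le> (1 / c) * (nu n r / real r)"
      using c(2)[OF r(1,3)] c(1) r by (simp add: field_simps)
    finally show "\<bar>kappa n r - exp (- harm r)\<bar> \<le> 1 / c * (nu n r / real r)" .
  qed (use c in simp)
qed

lemma kappa_asymptotics:
  "\<exists>C\<ge>0. \<forall>n r :: nat. 5 \<le> r \<and> r < n \<longrightarrow>
     \<bar>kappa n r - exp (- harm r)\<bar> \<le> C * (nu n r / real r *
       exp (- ((real n / real r) powr (1 - 4 / real r) / (4 * pi\<^sup>2 * (ln (real n / real r + 1))\<^sup>2))))"
proof -
  obtain U where U: "U \<ge> 4" and exponent: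
    "\<And>u r l. u \<ge> U \<Longrightarrow> real r \<ge> 5 \<Longrightarrow> 1 \<le> l \<Longrightarrow> l \<le> 2 * ln (2 * u) \<Longrightarrow>
     (3 + 4 * sqrt u) * l + 2 * exp (l / real r) - u / (4 * exp (l / real r) * l\<^sup>2)
       \<le> - (u powr (1 - 4 / real r) / (4 * pi\<^sup>2 * (ln (u + 1))\<^sup>2))"
    using saddle_exponent_bound by blast
  obtain C where C: "C \<ge> 0" and small: "\<And>n r. 1 \<le> r \<Longrightarrow> r < n \<Longrightarrow> real n \<le> U * real r \<Longrightarrow>
    \<bar>kappa n r - exp (- harm r)\<bar> \<le> C * (nu n r / real r)"
    using kappa_error_bounded_ratio[of U] U by auto
  define B where "B = U / (4 * pi\<^sup>2 * (ln 2)\<^sup>2)"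
  show ?thesis
  proof (intro exI[of _ "max (32 * exp 4) (C * exp B)"] conjI allI impI)
    fix n r :: nat assume nr: "5 \<le> r \<and> r < n"
    define u where "u = real n / real r"
    define e where "e = - (u powr (1 - 4 / real r) / (4 * pi\<^sup>2 * (ln (u + 1))\<^sup>2))"
    have q0: "nu n r / real r \<ge> 0" using nu_nonneg by simp
    have u1: "u \<ge> 1" using nr by (simp add: u_def)
    have "\<bar>kappa n r - exp (- harm r)\<bar> \<le> max (32 * exp 4) (C * exp B) * (nu n r / real r * exp e)"
    proof (cases "u \<ge> U")
      case True
      have "4 * r \<le> n"
      proof -
        have "4 * real r \<le> U * real r" using U by (intro mult_right_mono) auto
        also have "\<dots> \<le> u * real r" using True by (intro mult_right_mono) auto
        also have "\<dots> = real n" using nr by (simp add: u_def)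
        finally have "real (4 * r) \<le> real n" by simp
        then show ?thesis by (simp only: of_nat_le_iff)
      qed
      then obtain l where l: "1 \<le> l" "l \<le> 2 * ln (2 * u)"
        and b: "\<bar>kappa n r - exp (- harm r)\<bar> \<le> 32 * exp 4 * (nu n r / real r *
          exp ((3 + 4 * sqrt u) * l + 2 * exp (l / real r) - u / (4 * exp (l / real r) * l\<^sup>2)))"
        using kappa_error_saddle_bound[of r n] nr unfolding u_def by auto
      note b
      also have "32 * exp 4 * (nu n r / real r *
          exp ((3 + 4 * sqrt u) * l + 2 * exp (l / real r) - u / (4 * exp (l / real r) * l\<^sup>2)))
          \<le> max (32 * exp 4) (C * exp B) * (nu n r / real r * exp e)"
      proof (intro mult_mono order_refl q0)
        show "exp ((3 + 4 * sqrt u) * l + 2 * exp (l / real r) - u / (4 * exp (l / real r) * l\<^sup>2)) \<le> exp e"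
          unfolding e_def exp_le_cancel_iff by (rule exponent[OF True _ l]) (use nr in simp)
      qed (auto intro: mult_nonneg_nonneg q0 simp: le_max_iff_disj nu_nonneg)
      finally show ?thesis .
    next
      case False
      have "- e \<le> B"
      proof -
        have "u powr (1 - 4 / real r) \<le> u powr 1" using u1 nr by (intro powr_mono) auto
        also have "\<dots> \<le> U" using False u1 by simp
        finally have a: "u powr (1 - 4 / real r) \<le> U" .
        have "(ln 2)\<^sup>2 \<le> (ln (u + 1))\<^sup>2" using u1 by (intro power_mono) auto
        then have "4 * pi\<^sup>2 * (ln 2)\<^sup>2 \<le> 4 * pi\<^sup>2 * (ln (u + 1))\<^sup>2" by (intro mult_left_mono) auto
        then show ?thesis unfolding e_def B_def minus_minus using a U by (intro frac_le) auto
      qed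
      then have eB: "1 \<le> exp B * exp e" by (simp flip: exp_add)
      have "\<bar>kappa n r - exp (- harm r)\<bar> \<le> C * (nu n r / real r)"
      proof (rule small)
        show "real n \<le> U * real r" using False nr by (simp add: u_def field_simps)
      qed (use nr in auto)
      also have "\<dots> * 1 \<le> C * (nu n r / real r) * (exp B * exp e)"
        by (intro mult_left_mono eB mult_nonneg_nonneg C q0)
      also have "\<dots> = (C * exp B) * (nu n r / real r * exp e)" by simp
      also have "\<dots> \<le> max (32 * exp 4) (C * exp B) * (nu n r / real r * exp e)"
        by (intro mult_right_mono mult_nonneg_nonneg q0) auto
      finally show ?thesis by simp
    qed
    then show "\<bar>kappa n r - exp (- harm r)\<bar> \<le> max (32 * exp 4) (C * exp B) * (nu n r / real r *
       exp (- ((real n / real r) powr (1 - 4 / real r) / (4 * pi\<^sup>2 * (ln (real n / real r + 1))\<^sup>2))))"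
      by (simp only: e_def u_def)
  qed (simp add: le_max_iff_disj)
qed

theorem theorem3p4:
  shows "(\<forall>\<epsilon>::real. \<epsilon> > 0 \<longrightarrow>
           (\<exists>C::real. \<forall>n r :: nat. 5 \<le> r \<and> r < n \<longrightarrow>
             (let u = real n / real r in
               \<bar>kappa n r - exp (- harm r)\<bar> \<le>
                 C * (nu n r / real r *
                   exp (- (u powr (1 - 4 / real r) * (1 - \<epsilon>) / (4 * pi\<^sup>2 * (ln (u + 1))\<^sup>2)))))))
       \<and> (\<exists>C::real. \<forall>n r :: nat. 2 \<le> r \<and> r < 5 \<and> r < n \<longrightarrow>
             \<bar>kappa n r - exp (- harm r)\<bar> \<le> C * (nu n r * real n powr (5 / 2)))"
proof (intro conjI allI impI)
  fix \<epsilon> :: real assume \<epsilon>: "\<epsilon> > 0"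
  obtain C where C: "C \<ge> 0" and bound: "\<And>n r :: nat. 5 \<le> r \<and> r < n \<Longrightarrow>
     \<bar>kappa n r - exp (- harm r)\<bar> \<le> C * (nu n r / real r *
       exp (- ((real n / real r) powr (1 - 4 / real r) / (4 * pi\<^sup>2 * (ln (real n / real r + 1))\<^sup>2))))"
    using kappa_asymptotics by blast
  show "\<exists>C::real. \<forall>n r :: nat. 5 \<le> r \<and> r < n \<longrightarrow>
             (let u = real n / real r in
               \<bar>kappa n r - exp (- harm r)\<bar> \<le>
                 C * (nu n r / real r *
                   exp (- (u powr (1 - 4 / real r) * (1 - \<epsilon>) / (4 * pi\<^sup>2 * (ln (u + 1))\<^sup>2)))))"
  proof (intro exI[of _ C] allI impI)
    fix n r :: nat assume nr: "5 \<le> r \<and> r < n"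
    define u where "u = real n / real r"
    have "u powr (1 - 4 / real r) * (1 - \<epsilon>) \<le> u powr (1 - 4 / real r) * 1"
      using \<epsilon> by (intro mult_left_mono) auto
    then have "u powr (1 - 4 / real r) * (1 - \<epsilon>) / (4 * pi\<^sup>2 * (ln (u + 1))\<^sup>2)
        \<le> u powr (1 - 4 / real r) / (4 * pi\<^sup>2 * (ln (u + 1))\<^sup>2)"
      by (intro divide_right_mono) auto
    then have "C * (nu n r / real r * exp (- (u powr (1 - 4 / real r) / (4 * pi\<^sup>2 * (ln (u + 1))\<^sup>2))))
        \<le> C * (nu n r / real r * exp (- (u powr (1 - 4 / real r) * (1 - \<epsilon>) / (4 * pi\<^sup>2 * (ln (u + 1))\<^sup>2))))"
      using C nu_nonneg by (intro mult_left_mono) auto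
    then show "let u = real n / real r in
               \<bar>kappa n r - exp (- harm r)\<bar> \<le>
                 C * (nu n r / real r *
                   exp (- (u powr (1 - 4 / real r) * (1 - \<epsilon>) / (4 * pi\<^sup>2 * (ln (u + 1))\<^sup>2))))"
      using bound[OF nr] by (simp add: Let_def u_def)
  qed
next
  show "\<exists>C::real. \<forall>n r :: nat. 2 \<le> r \<and> r < 5 \<and> r < n \<longrightarrow>
             \<bar>kappa n r - exp (- harm r)\<bar> \<le> C * (nu n r * real n powr (5 / 2))"
  proof (intro exI[of _ 8] allI impI)
    fix n r :: nat assume nr: "2 \<le> r \<and> r < 5 \<and> r < n"
    have "\<bar>kappa n r - exp (- harm r)\<bar> \<le> 2 * real r * nu n r"
      using nr by (intro kappa_error_le_nu) auto
    also have "\<dots> \<le> 8 * (nu n r * 1)"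
      using nr nu_nonneg[of n r] by (auto intro: mult_right_mono)
    also have "\<dots> \<le> 8 * (nu n r * real n powr (5 / 2))"
      using nr by (intro mult_left_mono nu_nonneg ge_one_powr_ge_zero) auto
    finally show "\<bar>kappa n r - exp (- harm r)\<bar> \<le> 8 * (nu n r * real n powr (5 / 2))" .
  qed
qed

end
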